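(* Let $(G,c)$ be a network satisfying the standing assumptions. For every $\xi\in\operatorname{dom}\Phi=\operatorname{span}\{\delta_x\}_{x\in G}$, the spectral measure $\mu^{\mathcal F}_{\Phi\xi}$ of $\Delta_{\mathcal F}$ at $\Phi\xi$ and the spectral measure $\mu^{\ell^2}_{\xi}$ of $\Delta_2$ at $\xi$ are related by $$\lambda\,d\mu^{\mathcal F}_{\Phi\xi}=d\mu^{\ell^2}_{\xi},$$ where $\lambda$ is the spectral parameter. In particular, $\mu^{\mathcal F}_{\Phi\xi}$ and $\mu^{\ell^2}_\xi$ are mutually absolutely continuous on $(0,\infty)$, with Radon-Nikodym derivative $\lambda$.
   Context: A network $(G,c)$ is a connected undirected graph $G$ (we write $x\in G$ for vertices) with a symmetric conductance function $c:G\times G\to[0,\infty)$, where $x,y$ are neighbours, $x\sim y$, iff $c_{xy}>0$. Every vertex has finitely many neighbours. Fix a reference vertex $o\in G$. The Laplacian acts on $u:G\to\mathbb R$ by $(\Delta u)(x)=\sum_{y\sim x}c_{xy}(u(x)-u(y))$. The energy form is $\mathcal E(u,v)=\frac12\sum_{x,y\in G}c_{xy}(u(x)-u(y))(v(x)-v(y))$ on $\operatorname{dom}\mathcal E=\{u:G\to\mathbb R:\mathcal E(u,u)<\infty\}$. The energy space $\mathcal H_{\mathcal E}=\operatorname{dom}\mathcal E/\mathbb R\mathbf 1$ (functions modulo constants) is a Hilbert space with inner product $\langle u,v\rangle_{\mathcal E}=\mathcal E(u,v)$; $\Delta$ acts unambiguously on classes, and $\Delta u$ may be regarded as a function or as its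 class. For $x\in G$, $v_x\in\mathcal H_{\mathcal E}$ is the unique element with $\langle v_x,u\rangle_{\mathcal E}=u(x)-u(o)$ for all $u\in\mathcal H_{\mathcal E}$. A monopole at $x$ is $w\in\mathcal H_{\mathcal E}$ with $\Delta w=\delta_x$ (the characteristic function of $\{x\}$). Standing assumptions: $G$ is infinite and the network is transient (equivalently, monopoles exist). Let $w_o$ be the unique energy-minimizing monopole at $o$, and $w_x^{v}:=w_o+v_x$ for $x\in G$ (so $w_o^v=w_o$). $\Delta_{\mathcal E}$: the closure in $\mathcal H_{\mathcal E}$ of $\Delta$ restricted to $\operatorname{span}\{w_x^v\}_{x\in G}$; it is densely defined and non-negative. Its Friedrichs extension $\Delta_{\mathcal F}$: let $q_\Delta$ be the closure of the quadratic form $u\mapsto\langle u,\Delta u\rangle_{\mathcal E}+\|u\|_{\mathcal E}^2$, $u\in\operatorname{dom}\Delta_{\mathcal E}$; then $\Delta_{\mathcal F}$ is the non-negative self-adjoint extension of $\Delta_{\mathcal E}$ with $\operatorname{dom}\Delta_{\mathcal F}^{1/2}=\operatorname{dom}q_\Delta$ and $q_\Delta(u)=\|\Delta_{\mathcal F}^{1/2}u\|_{\mathcal E}^2+\|u\|_{\mathcal E}^2$. $\ell^2(G)$ carries $\langle u,v\rangle_2=\sum_x u(x)v(x)$. $\Delta_2$: the closure in $\ell^2(G)$ of $\Delta$ on $\operatorname{span}\{\delta_x\}_{x\in G}$; it is known to be self-adjoint and non-negative. $\Phi$: the linear map from $\operatorname{span}\{\delta_x\}_{x\in G}\subset\ell^2(G)$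 to $\mathcal H_{\mathcal E}$ with $\Phi\delta_x=w_x^v$. If $P_{\mathcal F}$ and $P_2$ are the projection-valued spectral measures of $\Delta_{\mathcal F}$ (on $\mathcal H_{\mathcal E}$) and $\Delta_2$ (on $\ell^2(G)$), then $\mu^{\mathcal F}_u(A)=\|P_{\mathcal F}(A)u\|_{\mathcal E}^2$ and $\mu^{\ell^2}_\xi(A)=\|P_2(A)\xi\|_2^2$ for Borel $A\subset[0,\infty)$. *)

theory Defs
  imports "HOL-Analysis.Analysis"
begin

section \<open>Real Hilbert spaces with an explicit carrier\<close>

text \<open>
  The energy space depends on the conductance function and hence cannot be a type. Inner product
  spaces are therefore records with an explicit carrier; this also covers the sequence space
  of square summable functions on the vertices.
\<close>

record 'h hspace =
  hcarrier :: "'h set"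
  hzero :: 'h
  hadd :: "'h \<Rightarrow> 'h \<Rightarrow> 'h"
  hscale :: "real \<Rightarrow> 'h \<Rightarrow> 'h"
  hinner :: "'h \<Rightarrow> 'h \<Rightarrow> real"

definition hdiff :: "'h hspace \<Rightarrow> 'h \<Rightarrow> 'h \<Rightarrow> 'h" where
  "hdiff H u v = hadd H u (hscale H (-1) v)"

definition hnorm :: "'h hspace \<Rightarrow> 'h \<Rightarrow> real" where
  "hnorm H u = sqrt (hinner H u u)"

definition hsubspace :: "'h hspace \<Rightarrow> 'h set \<Rightarrow> bool" where
  "hsubspace H V \<longleftrightarrow> V \<subseteq> hcarrier H \<and> hzero H \<in> V \<and>
     (\<forall>u\<in>V. \<forall>v\<in>V. hadd H u v \<in> V) \<and> (\<forall>a. \<forall>u\<in>V. hscale H a u \<in> V)"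

definition hspan :: "'h hspace \<Rightarrow> 'h set \<Rightarrow> 'h set" where
  "hspan H S = \<Inter>{V. hsubspace H V \<and> S \<subseteq> V}"

definition hdense :: "'h hspace \<Rightarrow> 'h set \<Rightarrow> bool" where
  "hdense H D \<longleftrightarrow> (\<forall>u\<in>hcarrier H. \<forall>e>0. \<exists>v\<in>D. hnorm H (hdiff H u v) < e)"


section \<open>Unbounded operators\<close>

text \<open>
  An unbounded operator is identified with its graph: \<^term>\<open>(u, w) \<in> T\<close> means that
  \<^term>\<open>u\<close> lies in the domain of \<^term>\<open>T\<close> and is mapped to \<^term>\<open>w\<close>. The
  domain is \<^term>\<open>Domain T\<close>, extension of operators is inclusion, and the composition of
  operators (with its natural domain) is relational composition.
\<close>

definition op_app :: "('h \<times> 'h) set \<Rightarrow> 'h \<Rightarrow> 'h" where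
  "op_app T u = (THE w. (u, w) \<in> T)"

definition op_closure :: "'h hspace \<Rightarrow> ('h \<times> 'h) set \<Rightarrow> ('h \<times> 'h) set" where
  "op_closure H T = {(u, w). u \<in> hcarrier H \<and> w \<in> hcarrier H \<and>
     (\<forall>e>0. \<exists>(u', w')\<in>T. hnorm H (hdiff H u u') < e \<and> hnorm H (hdiff H w w') < e)}"

definition op_adjoint :: "'h hspace \<Rightarrow> ('h \<times> 'h) set \<Rightarrow> ('h \<times> 'h) set" where
  "op_adjoint H T = {(u, w). u \<in> hcarrier H \<and> w \<in> hcarrier H \<and>
     (\<forall>(x, y)\<in>T. hinner H y u = hinner H x w)}"

definition self_adjoint :: "'h hspace \<Rightarrow> ('h \<times> 'h) set \<Rightarrow> bool" where
  "self_adjoint H T \<longleftrightarrow> T \<subseteq> hcarrier H \<times> hcarrier H \<and> single_valued T \<and>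
     hdense H (Domain T) \<and> T = op_adjoint H T"

definition op_nonneg :: "'h hspace \<Rightarrow> ('h \<times> 'h) set \<Rightarrow> bool" where
  "op_nonneg H T \<longleftrightarrow> (\<forall>(u, w)\<in>T. 0 \<le> hinner H u w)"

text \<open>The non-negative self-adjoint square root \<open>S\<close> of \<open>T\<close>.\<close>

definition op_sqrt :: "'h hspace \<Rightarrow> ('h \<times> 'h) set \<Rightarrow> ('h \<times> 'h) set \<Rightarrow> bool" where
  "op_sqrt H T S \<longleftrightarrow> self_adjoint H S \<and> op_nonneg H S \<and> S O S = T"


subsection \<open>The Friedrichs extension\<close>

text \<open>
  Closure of a quadratic form \<open>t\<close> with domain \<open>D\<close>, again as a graph: \<open>u\<close> is in
  its domain, with value \<open>r\<close>, if some sequence in \<open>D\<close> converges to \<open>u\<close> in the Hilbert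
  space, is Cauchy with respect to \<open>t\<close>, and has \<open>t\<close>-values converging to \<open>r\<close>.
\<close>

definition form_closure ::
  "'h hspace \<Rightarrow> 'h set \<Rightarrow> ('h \<Rightarrow> real) \<Rightarrow> ('h \<times> real) set" where
  "form_closure H D t = {(u, r). u \<in> hcarrier H \<and>
     (\<exists>f::nat \<Rightarrow> 'h. (\<forall>n. f n \<in> D) \<and>
        (\<lambda>n. hnorm H (hdiff H (f n) u)) \<longlonglongrightarrow> 0 \<and>
        (\<forall>e>0. \<exists>N. \<forall>m\<ge>N. \<forall>n\<ge>N. t (hdiff H (f m) (f n)) < e) \<and>
        (\<lambda>n. t (f n)) \<longlonglongrightarrow> r)}"

definition shifted_form :: "'h hspace \<Rightarrow> ('h \<times> 'h) set \<Rightarrow> 'h \<Rightarrow> real" where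
  "shifted_form H T u = hinner H u (op_app T u) + (hnorm H u)\<^sup>2"

definition closed_form :: "'h hspace \<Rightarrow> ('h \<times> 'h) set \<Rightarrow> ('h \<times> real) set" where
  "closed_form H T = form_closure H (Domain T) (shifted_form H T)"

definition friedrichs_extension ::
  "'h hspace \<Rightarrow> ('h \<times> 'h) set \<Rightarrow> ('h \<times> 'h) set \<Rightarrow> bool" where
  "friedrichs_extension H T F \<longleftrightarrow>
     self_adjoint H F \<and> op_nonneg H F \<and> T \<subseteq> F \<and>
     (\<exists>S. op_sqrt H F S \<and> Domain S = Domain (closed_form H T) \<and>
        (\<forall>(u, s)\<in>S. (u, (hnorm H s)\<^sup>2 + (hnorm H u)\<^sup>2) \<in> closed_form H T))"


subsection \<open>Projection-valued measures and the spectral resolution\<close>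

definition orth_projection :: "'h hspace \<Rightarrow> ('h \<Rightarrow> 'h) \<Rightarrow> bool" where
  "orth_projection H p \<longleftrightarrow>
     (\<forall>u\<in>hcarrier H. p u \<in> hcarrier H \<and> p (p u) = p u) \<and>
     (\<forall>u\<in>hcarrier H. \<forall>v\<in>hcarrier H. p (hadd H u v) = hadd H (p u) (p v)) \<and>
     (\<forall>a. \<forall>u\<in>hcarrier H. p (hscale H a u) = hscale H a (p u)) \<and>
     (\<forall>u\<in>hcarrier H. \<forall>v\<in>hcarrier H. hinner H (p u) v = hinner H u (p v))"

definition proj_valued_measure ::
  "'h hspace \<Rightarrow> 'm measure \<Rightarrow> ('m set \<Rightarrow> 'h \<Rightarrow> 'h) \<Rightarrow> bool" where
  "proj_valued_measure H M P \<longleftrightarrow>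
     (\<forall>A\<in>sets M. orth_projection H (P A)) \<and>
     (\<forall>u\<in>hcarrier H. P (space M) u = u) \<and>
     (\<forall>A\<in>sets M. \<forall>B\<in>sets M. \<forall>u\<in>hcarrier H. P (A \<inter> B) u = P A (P B u)) \<and>
     (\<forall>F::nat \<Rightarrow> 'm set. range F \<subseteq> sets M \<longrightarrow> disjoint_family F \<longrightarrow>
        (\<forall>u\<in>hcarrier H. \<forall>v\<in>hcarrier H.
           (\<lambda>n. hinner H (P (F n) u) v) sums hinner H (P (\<Union>n. F n) u) v))"

definition spectral_measure ::
  "'h hspace \<Rightarrow> 'm measure \<Rightarrow> ('m set \<Rightarrow> 'h \<Rightarrow> 'h) \<Rightarrow> 'h \<Rightarrow> 'm measure" where
  "spectral_measure H M P u =
     measure_of (space M) (sets M) (\<lambda>A. ennreal ((hnorm H (P A u))\<^sup>2))"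

text \<open>
  The self-adjoint operator \<open>\<integral> f dP\<close>, with domain the vectors \<open>u\<close> for which
  \<open>f\<close> is square integrable with respect to the spectral measure of \<open>u\<close>. It is given weakly,
  by \<open>\<langle>(\<integral> f dP) u, v\<rangle> = \<integral> f d\<langle>P u, v\<rangle>\<close> for all \<open>v\<close> in this (dense) domain, where the
  signed measure \<open>\<langle>P u, v\<rangle>\<close> is one quarter of the difference of the spectral measures of
  \<open>u + v\<close> and \<open>u - v\<close>.
\<close>

definition pvm_domain ::
  "'h hspace \<Rightarrow> 'm measure \<Rightarrow> ('m set \<Rightarrow> 'h \<Rightarrow> 'h) \<Rightarrow> ('m \<Rightarrow> real) \<Rightarrow> 'h set" where
  "pvm_domain H M P f = {u \<in> hcarrier H.
     (\<integral>\<^sup>+ l. ennreal ((f l)\<^sup>2) \<partial>spectral_measure H M P u) < \<infinity>}"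

definition pvm_integral ::
  "'h hspace \<Rightarrow> 'm measure \<Rightarrow> ('m set \<Rightarrow> 'h \<Rightarrow> 'h) \<Rightarrow> ('m \<Rightarrow> real) \<Rightarrow> ('h \<times> 'h) set" where
  "pvm_integral H M P f = {(u, w). u \<in> pvm_domain H M P f \<and> w \<in> hcarrier H \<and>
     (\<forall>v\<in>pvm_domain H M P f.
        hinner H w v =
          ((\<integral> l. f l \<partial>spectral_measure H M P (hadd H u v)) -
           (\<integral> l. f l \<partial>spectral_measure H M P (hdiff H u v))) / 4)}"

abbreviation halfline :: "real measure" where
  "halfline \<equiv> restrict_space borel {0..}"

text \<open>\<open>P\<close> is the projection-valued spectral measure of the non-negative self-adjoint
  operator \<open>T\<close>, that is, \<open>T = \<integral> \<lambda> dP(\<lambda>)\<close>.\<close>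

definition spectral_resolution ::
  "'h hspace \<Rightarrow> ('h \<times> 'h) set \<Rightarrow> (real set \<Rightarrow> 'h \<Rightarrow> 'h) \<Rightarrow> bool" where
  "spectral_resolution H T P \<longleftrightarrow>
     proj_valued_measure H halfline P \<and> T = pvm_integral H halfline P (\<lambda>l. l)"


section \<open>Networks\<close>

text \<open>The vertex set is the type \<open>'v\<close>.\<close>

definition network :: "('v \<Rightarrow> 'v \<Rightarrow> real) \<Rightarrow> bool" where
  "network c \<longleftrightarrow>
     (\<forall>x y. 0 \<le> c x y) \<and> (\<forall>x y. c x y = c y x) \<and>
     (\<forall>x. finite {y. c x y > 0}) \<and>
     (\<forall>x y. (x, y) \<in> {(a, b). c a b > 0}\<^sup>*)"

definition laplacian :: "('v \<Rightarrow> 'v \<Rightarrow> real) \<Rightarrow> ('v \<Rightarrow> real) \<Rightarrow> 'v \<Rightarrow> real" where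
  "laplacian c u x = (\<Sum>y\<in>{y. c x y > 0}. c x y * (u x - u y))"

definition point_mass :: "'v \<Rightarrow> 'v \<Rightarrow> real" where
  "point_mass x = (\<lambda>y. if y = x then 1 else 0)"

definition energy :: "('v \<Rightarrow> 'v \<Rightarrow> real) \<Rightarrow> ('v \<Rightarrow> real) \<Rightarrow> ('v \<Rightarrow> real) \<Rightarrow> real" where
  "energy c u v = infsum (\<lambda>(x, y). c x y * (u x - u y) * (v x - v y)) UNIV / 2"

definition dom_energy :: "('v \<Rightarrow> 'v \<Rightarrow> real) \<Rightarrow> ('v \<Rightarrow> real) set" where
  "dom_energy c = {u. (\<lambda>(x, y). c x y * (u x - u y)\<^sup>2) summable_on UNIV}"


subsection \<open>The energy space\<close>

text \<open>
  Its elements are the classes modulo constants of functions of finite energy; operations are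
  computed on representatives.
\<close>

definition const_class :: "('v \<Rightarrow> real) \<Rightarrow> ('v \<Rightarrow> real) set" where
  "const_class u = {v. \<exists>k. \<forall>x. v x = u x + k}"

definition rep :: "('v \<Rightarrow> real) set \<Rightarrow> 'v \<Rightarrow> real" where
  "rep U = (SOME u. u \<in> U)"

definition energy_space :: "('v \<Rightarrow> 'v \<Rightarrow> real) \<Rightarrow> ('v \<Rightarrow> real) set hspace" where
  "energy_space c = \<lparr>
     hcarrier = const_class ` dom_energy c,
     hzero = const_class (\<lambda>x. 0),
     hadd = (\<lambda>U V. const_class (\<lambda>x. rep U x + rep V x)),
     hscale = (\<lambda>a U. const_class (\<lambda>x. a * rep U x)),
     hinner = (\<lambda>U V. energy c (rep U) (rep V)) \<rparr>"

lemma rep_const_class: "\<exists>k. \<forall>x. rep (const_class u) x = u x + k"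
proof -
  have "u \<in> const_class u" by (auto simp: const_class_def intro!: exI[of _ 0])
  then have "rep (const_class u) \<in> const_class u" unfolding rep_def by (rule someI[where P = "\<lambda>v. v \<in> const_class u"])
  then show ?thesis by (simp add: const_class_def)
qed

lemma hinner_energy_space:
  "hinner (energy_space c) (const_class u) (const_class v) = energy c u v"
proof -
  obtain j k where "\<And>x. rep (const_class u) x = u x + j" "\<And>x. rep (const_class v) x = v x + k"
    using rep_const_class by metis
  then show ?thesis by (simp add: energy_space_def energy_def)
qed

lemma laplacian_rep: "laplacian c (rep (const_class u)) = laplacian c u"
proof -
  obtain k where "\<And>x. rep (const_class u) x = u x + k"
    using rep_const_class by metis
  then show ?thesis by (simp add: laplacian_def fun_eq_iff)
qed

definition dipole :: "('v \<Rightarrow> 'v \<Rightarrow> real) \<Rightarrow> 'v \<Rightarrow> 'v \<Rightarrow> ('v \<Rightarrow> real) set" where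
  "dipole c x0 x = (THE v. v \<in> hcarrier (energy_space c) \<and>
     (\<forall>u\<in>hcarrier (energy_space c). hinner (energy_space c) v u = rep u x - rep u x0))"

definition monopole :: "('v \<Rightarrow> 'v \<Rightarrow> real) \<Rightarrow> 'v \<Rightarrow> ('v \<Rightarrow> real) set \<Rightarrow> bool" where
  "monopole c x w \<longleftrightarrow>
     w \<in> hcarrier (energy_space c) \<and> laplacian c (rep w) = point_mass x"

text \<open>A network is transient iff monopoles exist; this is taken as the definition. Since
  dipoles always exist, a monopole at one vertex yields monopoles at all vertices.\<close>

definition transient :: "('v \<Rightarrow> 'v \<Rightarrow> real) \<Rightarrow> bool" where
  "transient c \<longleftrightarrow> (\<exists>x w. monopole c x w)"

definition min_monopole :: "('v \<Rightarrow> 'v \<Rightarrow> real) \<Rightarrow> 'v \<Rightarrow> ('v \<Rightarrow> real) set" where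
  "min_monopole c x0 = (THE w. monopole c x0 w \<and>
     (\<forall>w'. monopole c x0 w' \<longrightarrow> hnorm (energy_space c) w \<le> hnorm (energy_space c) w'))"

definition wv :: "('v \<Rightarrow> 'v \<Rightarrow> real) \<Rightarrow> 'v \<Rightarrow> 'v \<Rightarrow> ('v \<Rightarrow> real) set" where
  "wv c x0 x = hadd (energy_space c) (min_monopole c x0) (dipole c x0 x)"

text \<open>Here the function \<open>\<Delta> u\<close> is regarded as its class.\<close>

definition Delta_E ::
  "('v \<Rightarrow> 'v \<Rightarrow> real) \<Rightarrow> 'v \<Rightarrow> (('v \<Rightarrow> real) set \<times> ('v \<Rightarrow> real) set) set" where
  "Delta_E c x0 = op_closure (energy_space c)
     {(u, const_class (laplacian c (rep u))) |u. u \<in> hspan (energy_space c) (range (wv c x0))}"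


subsection \<open>The space of square summable functions\<close>

definition ell2 :: "('v \<Rightarrow> real) hspace" where
  "ell2 = \<lparr>
     hcarrier = {u. (\<lambda>x. (u x)\<^sup>2) summable_on UNIV},
     hzero = (\<lambda>x. 0),
     hadd = (\<lambda>u v x. u x + v x),
     hscale = (\<lambda>a u x. a * u x),
     hinner = (\<lambda>u v. infsum (\<lambda>x. u x * v x) UNIV) \<rparr>"

definition dom_Phi :: "('v \<Rightarrow> real) set" where
  "dom_Phi = hspan ell2 (range point_mass)"

definition Delta_2 :: "('v \<Rightarrow> 'v \<Rightarrow> real) \<Rightarrow> (('v \<Rightarrow> real) \<times> ('v \<Rightarrow> real)) set" where
  "Delta_2 c = op_closure ell2 {(u, laplacian c u) |u. u \<in> dom_Phi}"

text \<open>The linear extension of \<open>\<delta>\<^sub>x \<mapsto> w\<^sub>x\<close>: the class of the finite sum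
  \<open>\<Sum>\<^sub>x \<xi>(x) w\<^sub>x\<close>, computed on representatives.\<close>

definition Phi :: "('v \<Rightarrow> 'v \<Rightarrow> real) \<Rightarrow> 'v \<Rightarrow> ('v \<Rightarrow> real) \<Rightarrow> ('v \<Rightarrow> real) set" where
  "Phi c x0 \<xi> = const_class (\<lambda>y. \<Sum>x\<in>{x. \<xi> x \<noteq> 0}. \<xi> x * rep (wv c x0 x) y)"

end

theory Submission
  imports Defs
begin

text \<open>
  Write \<open>\<Delta>\<close> for the pointwise Laplacian. The map \<open>\<Phi>\<close> intertwines the two operators: for finitely
  supported \<open>\<xi>\<close> the function \<open>\<Phi>\<xi>\<close> has Laplacian \<open>\<xi>\<close>, and the class of \<open>\<xi>\<close> is \<open>\<Phi>(\<Delta>\<xi>)\<close>, because both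
  have the same energy product with every function of finite energy (\<open>Phi_laplacian\<close>). Thus
  \<open>\<Delta>\<^sub>F \<Phi>\<xi> = \<Phi>\<Delta>\<xi>\<close> (\<open>Delta_E_Phi\<close>), and Green's identity gives \<open>\<langle>\<Phi>\<xi>, \<Delta>\<^sub>F \<Phi>\<xi>\<rangle> = \<parallel>\<xi>\<parallel>\<^sup>2\<close> (\<open>inner_Phi\<close>).

  Compare the measures \<open>\<nu>\<^sub>\<xi> = \<lambda> d\<mu>\<^sup>F\<close> at \<open>\<Phi>\<xi>\<close> and \<open>\<rho>\<^sub>\<xi> = \<mu>\<^sub>2\<close> at \<open>\<xi>\<close>. Both have total mass \<open>\<parallel>\<xi>\<parallel>\<^sup>2\<close>. For
  a vector \<open>u\<close> in the domain of \<open>T = \<integral> \<lambda> dP\<close> the spectral measure of \<open>Tu + u\<close> is \<open>(1 + \<lambda>)\<^sup>2\<close> times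
  that of \<open>u\<close> (\<open>spectral_op_plus_id\<close>); hence passing from \<open>\<xi>\<close> to \<open>\<Delta>\<xi> + \<xi>\<close> multiplies both
  \<open>\<nu>\<^sub>\<xi>\<close> and \<open>\<rho>\<^sub>\<xi>\<close> by \<open>(1 + \<lambda>)\<^sup>2\<close>. So if the integrals of \<open>(1 + \<lambda>)\<close> to the power \<open>-2k\<close> against
  \<open>\<nu>\<^sub>\<xi>\<close> and \<open>\<rho>\<^sub>\<xi>\<close> agree for all \<open>\<xi>\<close>, then those to the power \<open>-2(k + 1)\<close> agree for all \<open>\<xi>\<close> in the
  range of \<open>\<Delta> + 1\<close>. This range is dense for the norm of square summable functions
  (\<open>dense_range\<close>), and both integrals are non-negative quadratic forms bounded by \<open>\<parallel>\<xi>\<parallel>\<^sup>2\<close>, so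
  the agreement extends to all \<open>\<xi>\<close> (\<open>le_by_density\<close>). By induction on \<open>k\<close>, the images of \<open>\<nu>\<^sub>\<xi>\<close>
  and \<open>\<rho>\<^sub>\<xi>\<close> under \<open>\<lambda> \<mapsto> 1 / (1 + \<lambda>)\<^sup>2\<close> have the same moments. They live on the unit interval,
  where the Weierstrass approximation theorem makes moments determine a measure, and the map is
  injective, so \<open>\<nu>\<^sub>\<xi> = \<rho>\<^sub>\<xi>\<close> (\<open>measure_eq_if_resolvent_moments_eq\<close>).

  The density of the range rests on a maximum principle: a square summable function orthogonal
  to it satisfies \<open>\<Delta>l = -l\<close>; if \<open>l\<close> were positive somewhere, it would have a maximum, and there
  the equation fails. The same holds for \<open>-l\<close>, so \<open>l = 0\<close>. Hilbert space completeness enters through a single lemma on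
  minimizing sequences of square summable functions (\<open>ell2_minimizing_sequence\<close>). It serves
  here and, through the isometry \<open>u \<mapsto> grad u\<close> into functions on edges, in the existence of
  dipoles and of the minimal monopole.
\<close>

section \<open>Integrals against sums of measures\<close>

lemma nn_integral_measure_sum:
  assumes f: "f \<in> borel_measurable M" and sets: "sets N = sets M" "sets K = sets M"
    and eq: "\<And>X. X \<in> sets M \<Longrightarrow> emeasure M X = emeasure N X + emeasure K X"
  shows "(\<integral>\<^sup>+x. f x \<partial>M) = (\<integral>\<^sup>+x. f x \<partial>N) + (\<integral>\<^sup>+x. f x \<partial>K)"
proof -
  have m: "g \<in> borel_measurable N" "g \<in> borel_measurable K"
    if "g \<in> borel_measurable M" for g :: "'a \<Rightarrow> ennreal"
    using that measurable_cong_sets[OF sets(1) refl] measurable_cong_sets[OF sets(2) refl] by auto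
  from f show ?thesis
  proof (induction rule: borel_measurable_induct)
    case (cong f g)
    then show ?case
      using sets_eq_imp_space_eq[OF sets(1)] sets_eq_imp_space_eq[OF sets(2)]
      by (metis (no_types, lifting) nn_integral_cong)
  next
    case (set A)
    then show ?case using eq sets by simp
  next
    case (mult u a)
    then show ?case by (simp add: m nn_integral_cmult distrib_left)
  next
    case (add u v)
    then show ?case by (simp add: m nn_integral_add ac_simps)
  next
    case (seq U)
    have inc: "incseq (\<lambda>i. \<integral>\<^sup>+x. U i x \<partial>L)" for L
      using \<open>incseq U\<close> by (auto simp: incseq_def le_fun_def intro!: nn_integral_mono)
    have "(\<integral>\<^sup>+x. (SUP i. U i) x \<partial>M) = (SUP i. \<integral>\<^sup>+x. U i x \<partial>M)"
      by (simp add: nn_integral_monotone_convergence_SUP[OF \<open>incseq U\<close>] seq(1) image_comp)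
    also have "\<dots> = (SUP i. (\<integral>\<^sup>+x. U i x \<partial>N) + (\<integral>\<^sup>+x. U i x \<partial>K))"
      by (simp only: seq.IH)
    also have "\<dots> = (SUP i. \<integral>\<^sup>+x. U i x \<partial>N) + (SUP i. \<integral>\<^sup>+x. U i x \<partial>K)"
      by (rule ennreal_SUP_add[OF inc inc])
    also have "\<dots> = (\<integral>\<^sup>+x. (SUP i. U i) x \<partial>N) + (\<integral>\<^sup>+x. (SUP i. U i) x \<partial>K)"
      by (simp add: nn_integral_monotone_convergence_SUP[OF \<open>incseq U\<close>] m seq(1) image_comp)
    finally show ?case by simp
  qed
qed

text \<open>
  The one-sided form has weights, so that a measure which is dominated on sets with constants
  such as \<open>1 + e\<close> and \<open>1 + 1 / e\<close> is dominated with the same constants under the integral.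
\<close>

lemma nn_integral_le_measure_sum:
  assumes f: "f \<in> borel_measurable M" and sets: "sets N = sets M" "sets K = sets M"
    and le: "\<And>X. X \<in> sets M \<Longrightarrow> emeasure M X \<le> a * emeasure N X + b * emeasure K X"
  shows "(\<integral>\<^sup>+x. f x \<partial>M) \<le> a * (\<integral>\<^sup>+x. f x \<partial>N) + b * (\<integral>\<^sup>+x. f x \<partial>K)"
proof -
  have m: "g \<in> borel_measurable N" "g \<in> borel_measurable K"
    if "g \<in> borel_measurable M" for g :: "'a \<Rightarrow> ennreal"
    using that measurable_cong_sets[OF sets(1) refl] measurable_cong_sets[OF sets(2) refl] by auto
  from f show ?thesis
  proof (induction rule: borel_measurable_induct)
    case (cong f g)
    then show ?case
      using sets_eq_imp_space_eq[OF sets(1)] sets_eq_imp_space_eq[OF sets(2)]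
      by (metis (no_types, lifting) nn_integral_cong)
  next
    case (set A)
    then show ?case using le sets by simp
  next
    case (mult u k)
    have "k * (\<integral>\<^sup>+x. u x \<partial>M) \<le> k * (a * (\<integral>\<^sup>+x. u x \<partial>N) + b * (\<integral>\<^sup>+x. u x \<partial>K))"
      using mult by (intro mult_left_mono) auto
    then show ?case using mult by (simp add: m nn_integral_cmult distrib_left ac_simps)
  next
    case (add u v)
    then show ?case
      using add_mono[OF add.IH] by (simp add: m nn_integral_add distrib_left ac_simps)
  next
    case (seq U)
    have "(\<integral>\<^sup>+x. (SUP i. U i) x \<partial>M) = (SUP i. \<integral>\<^sup>+x. U i x \<partial>M)"
      by (simp add: nn_integral_monotone_convergence_SUP[OF \<open>incseq U\<close>] seq(1) image_comp)
    also have "\<dots> \<le> a * (\<integral>\<^sup>+x. (SUP i. U i) x \<partial>N) + b * (\<integral>\<^sup>+x. (SUP i. U i) x \<partial>K)"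
    proof (rule SUP_least)
      fix i
      have "U i x \<le> (SUP i. U i) x" for x by (auto intro: SUP_upper)
      then show "(\<integral>\<^sup>+x. U i x \<partial>M)
          \<le> a * (\<integral>\<^sup>+x. (SUP i. U i) x \<partial>N) + b * (\<integral>\<^sup>+x. (SUP i. U i) x \<partial>K)"
        by (intro order_trans[OF seq.IH] add_mono mult_left_mono nn_integral_mono) auto
    qed
    finally show ?case .
  qed
qed

section \<open>Spectral measures\<close>

text \<open>
  Spectral measures are built from the numbers \<open>\<langle>P A u, v\<rangle>\<close>, so identities between vectors are
  needed only after taking inner products; bilinearity therefore stands in for the vector space
  laws.
\<close>

locale inner_space =
  fixes H :: "'h hspace"
  assumes add_closed [simp]: "u \<in> hcarrier H \<Longrightarrow> v \<in> hcarrier H \<Longrightarrow> hadd H u v \<in> hcarrier H"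
    and scale_closed [simp]: "u \<in> hcarrier H \<Longrightarrow> hscale H a u \<in> hcarrier H"
    and inner_commute: "u \<in> hcarrier H \<Longrightarrow> v \<in> hcarrier H \<Longrightarrow> hinner H u v = hinner H v u"
    and inner_add_left [simp]: "u \<in> hcarrier H \<Longrightarrow> v \<in> hcarrier H \<Longrightarrow> z \<in> hcarrier H \<Longrightarrow>
      hinner H (hadd H u v) z = hinner H u z + hinner H v z"
    and inner_scale_left [simp]: "u \<in> hcarrier H \<Longrightarrow> z \<in> hcarrier H \<Longrightarrow>
      hinner H (hscale H a u) z = a * hinner H u z"
    and inner_nonneg: "u \<in> hcarrier H \<Longrightarrow> 0 \<le> hinner H u u"
begin

lemma inner_add_right [simp]: "u \<in> hcarrier H \<Longrightarrow> v \<in> hcarrier H \<Longrightarrow> z \<in> hcarrier H \<Longrightarrow>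
    hinner H z (hadd H u v) = hinner H z u + hinner H z v"
  by (simp add: inner_commute[of z])

lemma inner_scale_right [simp]: "u \<in> hcarrier H \<Longrightarrow> z \<in> hcarrier H \<Longrightarrow>
    hinner H z (hscale H a u) = a * hinner H z u"
  by (simp add: inner_commute[of z])

lemma diff_closed [simp]: "u \<in> hcarrier H \<Longrightarrow> v \<in> hcarrier H \<Longrightarrow> hdiff H u v \<in> hcarrier H"
  by (simp add: hdiff_def)

lemma norm_sq: "u \<in> hcarrier H \<Longrightarrow> (hnorm H u)\<^sup>2 = hinner H u u"
  by (simp add: hnorm_def inner_nonneg)

end

locale pvm_space = inner_space H for H :: "'h hspace" +
  fixes M :: "'m measure" and P :: "'m set \<Rightarrow> 'h \<Rightarrow> 'h"
  assumes pvm: "proj_valued_measure H M P"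
begin

lemma
  assumes "A \<in> sets M" "u \<in> hcarrier H"
  shows P_closed [simp]: "P A u \<in> hcarrier H" and P_idem: "P A (P A u) = P A u"
    and P_scale [simp]: "P A (hscale H a u) = hscale H a (P A u)"
  using pvm assms by (auto simp: proj_valued_measure_def orth_projection_def)

lemma
  assumes "A \<in> sets M" "u \<in> hcarrier H" "v \<in> hcarrier H"
  shows P_add [simp]: "P A (hadd H u v) = hadd H (P A u) (P A v)"
    and P_self_adjoint: "hinner H (P A u) v = hinner H u (P A v)"
  using pvm assms by (auto simp: proj_valued_measure_def orth_projection_def)

lemma P_Int: "A \<in> sets M \<Longrightarrow> B \<in> sets M \<Longrightarrow> u \<in> hcarrier H \<Longrightarrow> P A (P B u) = P (A \<inter> B) u"
  using pvm by (auto simp: proj_valued_measure_def)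

lemma P_space: "u \<in> hcarrier H \<Longrightarrow> P (space M) u = u"
  using pvm by (auto simp: proj_valued_measure_def)

lemma P_sums:
  "range F \<subseteq> sets M \<Longrightarrow> disjoint_family F \<Longrightarrow> u \<in> hcarrier H \<Longrightarrow> v \<in> hcarrier H \<Longrightarrow>
    (\<lambda>n::nat. hinner H (P (F n) u) v) sums hinner H (P (\<Union>n. F n) u) v"
  using pvm by (auto simp: proj_valued_measure_def)

text \<open>The signed measure \<open>\<langle>P u, v\<rangle>\<close>, handled through its values on sets.\<close>

definition form :: "'m set \<Rightarrow> 'h \<Rightarrow> 'h \<Rightarrow> real" where
  "form A u v = hinner H (P A u) v"

lemma form_commute:
  "A \<in> sets M \<Longrightarrow> u \<in> hcarrier H \<Longrightarrow> v \<in> hcarrier H \<Longrightarrow> form A u v = form A v u"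
  unfolding form_def by (metis P_closed P_self_adjoint inner_commute)

lemma form_bilinear [simp]:
  assumes "A \<in> sets M" "u \<in> hcarrier H" "v \<in> hcarrier H" "z \<in> hcarrier H"
  shows "form A (hadd H u v) z = form A u z + form A v z"
    and "form A z (hadd H u v) = form A z u + form A z v"
    and "form A (hscale H a u) z = a * form A u z"
    and "form A z (hscale H a u) = a * form A z u"
  using assms by (simp_all add: form_def)

lemma form_P_left [simp]:
  "A \<in> sets M \<Longrightarrow> B \<in> sets M \<Longrightarrow> u \<in> hcarrier H \<Longrightarrow> form A (P B u) v = form (A \<inter> B) u v"
  by (simp add: form_def P_Int)

lemma form_P_right [simp]:
  "A \<in> sets M \<Longrightarrow> B \<in> sets M \<Longrightarrow> u \<in> hcarrier H \<Longrightarrow> v \<in> hcarrier H \<Longrightarrow>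
    form A u (P B v) = form (A \<inter> B) u v"
  by (metis P_closed form_P_left form_commute sets.Int)

lemma norm_P: "A \<in> sets M \<Longrightarrow> u \<in> hcarrier H \<Longrightarrow> (hnorm H (P A u))\<^sup>2 = form A u u"
  unfolding form_def by (metis P_closed P_idem P_self_adjoint norm_sq)

lemma form_nonneg: "A \<in> sets M \<Longrightarrow> u \<in> hcarrier H \<Longrightarrow> 0 \<le> form A u u"
  by (metis norm_P zero_le_power2)

lemma form_space: "u \<in> hcarrier H \<Longrightarrow> form (space M) u v = hinner H u v"
  by (simp add: form_def P_space)

abbreviation \<mu> :: "'h \<Rightarrow> 'm measure" where
  "\<mu> u \<equiv> spectral_measure H M P u"

lemma sets_spectral [simp, measurable_cong]: "sets (\<mu> u) = sets M"
  by (simp add: spectral_measure_def sets.sigma_sets_eq sets.space_closed)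

lemma space_spectral [simp]: "space (\<mu> u) = space M"
  by (simp add: spectral_measure_def space_measure_of_conv)

lemma form_empty: "u \<in> hcarrier H \<Longrightarrow> form {} u u = 0"
proof -
  assume u: "u \<in> hcarrier H"
  have "(\<lambda>n::nat. form {} u u) sums form (\<Union>n::nat. {}) u u"
    unfolding form_def using u by (intro P_sums) (auto simp: disjoint_family_on_def)
  then have "(\<lambda>n::nat. form {} u u) \<longlonglongrightarrow> 0" by (blast dest: sums_summable summable_LIMSEQ_zero)
  then show ?thesis by (simp add: LIMSEQ_const_iff)
qed

lemma emeasure_spectral:
  assumes u: "u \<in> hcarrier H" and A: "A \<in> sets M"
  shows "emeasure (\<mu> u) A = ennreal (form A u u)"
proof -
  have "emeasure (\<mu> u) A = ennreal ((hnorm H (P A u))\<^sup>2)"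
    unfolding spectral_measure_def
  proof (rule emeasure_measure_of_sigma)
    show "sigma_algebra (space M) (sets M)" ..
    show "positive (sets M) (\<lambda>A. ennreal ((hnorm H (P A u))\<^sup>2))"
      using u by (simp add: positive_def norm_P form_empty)
    show "countably_additive (sets M) (\<lambda>A. ennreal ((hnorm H (P A u))\<^sup>2))"
    proof (rule countably_additiveI)
      fix F :: "nat \<Rightarrow> 'm set"
      assume F: "range F \<subseteq> sets M" "disjoint_family F" "(\<Union>i. F i) \<in> sets M"
      then have "(\<lambda>n. form (F n) u u) sums form (\<Union>n. F n) u u"
        unfolding form_def using P_sums u by blast
      then have "(\<Sum>n. ennreal (form (F n) u u)) = ennreal (form (\<Union>n. F n) u u)"
        using F u by (intro suminf_ennreal_eq form_nonneg) auto
      then show "(\<Sum>i. ennreal ((hnorm H (P (F i) u))\<^sup>2)) = ennreal ((hnorm H (P (\<Union> (range F)) u))\<^sup>2)"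
        using F u by (simp add: norm_P range_subsetD)
    qed
  qed (rule A)
  then show ?thesis using u A by (simp add: norm_P)
qed

lemma finite_spectral: "u \<in> hcarrier H \<Longrightarrow> finite_measure (\<mu> u)"
  by (rule finite_measureI) (simp add: emeasure_spectral)

text \<open>
  Continuity of the spectral measure in the vector, in a form that survives integration of an
  arbitrary non-negative function: in the expansion of \<open>\<parallel>P A (u + v)\<parallel>\<^sup>2\<close> the mixed term is at most
  \<open>e \<parallel>P A u\<parallel>\<^sup>2 + \<parallel>P A v\<parallel>\<^sup>2 / e\<close>.
\<close>

lemma emeasure_spectral_add_le:
  assumes u: "u \<in> hcarrier H" and v: "v \<in> hcarrier H" and A: "A \<in> sets M" and e: "e > 0"
  shows "emeasure (\<mu> (hadd H u v)) A
    \<le> ennreal (1 + e) * emeasure (\<mu> u) A + ennreal (1 + 1 / e) * emeasure (\<mu> v) A"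
proof -
  obtain s where s: "s > 0" "e = s * s"
    using e by (metis real_sqrt_gt_zero real_sqrt_mult_self abs_of_pos)
  \<comment> \<open>the bound is the non-negativity of the square of \<open>s u - v / s\<close>\<close>
  define z where "z = hadd H (hscale H s u) (hscale H (- 1 / s) v)"
  have "z \<in> hcarrier H" using u v by (simp add: z_def)
  then have "0 \<le> form A z z" by (rule form_nonneg[OF A])
  also have "form A z z = e * form A u u - 2 * form A u v + form A v v / e"
    using u v A s form_commute[OF A u v] by (simp add: z_def field_simps)
  finally have "form A (hadd H u v) (hadd H u v)
      \<le> (1 + e) * form A u u + (1 + 1 / e) * form A v v"
    using u v A form_commute[OF A u v] by (simp add: algebra_simps)
  then show ?thesis
    using u v A e
    by (simp add: emeasure_spectral form_nonneg flip: ennreal_mult ennreal_plus) 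
qed

lemma spectral_P:
  assumes u: "u \<in> hcarrier H" and C: "C \<in> sets M"
  shows "\<mu> (P C u) = density (\<mu> u) (indicator C)"
proof (rule measure_eqI)
  fix A assume "A \<in> sets (\<mu> (P C u))"
  then have A: "A \<in> sets M" by simp
  have "emeasure (density (\<mu> u) (indicator C)) A = (\<integral>\<^sup>+x. indicator (A \<inter> C) x \<partial>\<mu> u)"
    using A C by (simp add: emeasure_density indicator_inter_arith mult.commute)
  also have "\<dots> = emeasure (\<mu> u) (A \<inter> C)"
    using A C by (intro nn_integral_indicator) simp
  finally show "emeasure (\<mu> (P C u)) A = emeasure (density (\<mu> u) (indicator C)) A"
    using u A C by (simp add: emeasure_spectral Int_absorb2 inf.assoc)
qed simp

end

subsection \<open>The spectral measure of an image vector\<close>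

locale halfline_pvm = pvm_space H "halfline" P for H :: "'h hspace" and P
begin

lemma id_measurable [measurable]: "(\<lambda>l::real. l) \<in> borel_measurable halfline"
  by (rule measurable_restrict_space1) simp

abbreviation dom :: "'h set" where
  "dom \<equiv> pvm_domain H halfline P (\<lambda>l. l)"

abbreviation op :: "('h \<times> 'h) set" where
  "op \<equiv> pvm_integral H halfline P (\<lambda>l. l)"

text \<open>The value of the quadratic form of the operator, with \<open>\<infinity>\<close> outside the form domain.\<close>

abbreviation mean :: "'h \<Rightarrow> ennreal" where
  "mean u \<equiv> \<integral>\<^sup>+ l. ennreal l \<partial>\<mu> u"

lemma mean_finite:
  assumes "u \<in> dom" shows "mean u < \<infinity>"
proof -
  have u: "u \<in> hcarrier H" and fin: "(\<integral>\<^sup>+ l. ennreal (l\<^sup>2) \<partial>\<mu> u) < \<infinity>"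
    using assms by (auto simp: pvm_domain_def)
  have "l \<le> 1 + l\<^sup>2" for l :: real
    using zero_le_power2[of "l - 1 / 2"] by (simp add: power2_eq_square algebra_simps)
  then have "mean u \<le> (\<integral>\<^sup>+ l. 1 + ennreal (l\<^sup>2) \<partial>\<mu> u)"
    by (intro nn_integral_mono) (metis ennreal_1 ennreal_leI ennreal_plus zero_le_one zero_le_power2)
  also have "\<dots> = emeasure (\<mu> u) (space (\<mu> u)) + (\<integral>\<^sup>+ l. ennreal (l\<^sup>2) \<partial>\<mu> u)"
    by (subst nn_integral_add) simp_all
  also have "\<dots> < \<infinity>"
    using fin finite_measure.emeasure_finite[OF finite_spectral[OF u], of "space (\<mu> u)"]
    by (simp add: less_top)
  finally show ?thesis .
qed

lemma dom_add: 
  assumes u: "u \<in> dom" and v: "v \<in> dom" shows "hadd H u v \<in> dom"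
proof -
  have uv: "u \<in> hcarrier H" "v \<in> hcarrier H" using u v by (auto simp: pvm_domain_def)
  have "(\<integral>\<^sup>+ l. ennreal (l\<^sup>2) \<partial>\<mu> (hadd H u v))
      \<le> ennreal (1 + 1) * (\<integral>\<^sup>+ l. ennreal (l\<^sup>2) \<partial>\<mu> u) + ennreal (1 + 1 / 1) * (\<integral>\<^sup>+ l. ennreal (l\<^sup>2) \<partial>\<mu> v)"
    by (intro nn_integral_le_measure_sum) (use emeasure_spectral_add_le[OF uv, of _ 1] in auto)
  also have "\<dots> < \<infinity>"
    using u v by (simp add: pvm_domain_def ennreal_mult_less_top)
  finally show ?thesis using uv by (simp add: pvm_domain_def)
qed

lemma spectral_scale:
  assumes "u \<in> hcarrier H"
  shows "emeasure (\<mu> (hscale H a u)) A = ennreal (a\<^sup>2) * emeasure (\<mu> u) A"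
proof (cases "A \<in> sets halfline")
  case True
  then show ?thesis using assms
    by (simp add: emeasure_spectral form_nonneg power2_eq_square mult.assoc flip: ennreal_mult)
next
  case False
  then show ?thesis by (simp add: emeasure_notin_sets)
qed

lemma dom_scale: 
  assumes u: "u \<in> dom" shows "hscale H a u \<in> dom"
proof -
  have "(\<integral>\<^sup>+ l. ennreal (l\<^sup>2) \<partial>\<mu> (hscale H a u))
      \<le> ennreal (a\<^sup>2) * (\<integral>\<^sup>+ l. ennreal (l\<^sup>2) \<partial>\<mu> u) + 0 * (\<integral>\<^sup>+ l. ennreal (l\<^sup>2) \<partial>\<mu> u)"
    by (intro nn_integral_le_measure_sum) (use u in \<open>auto simp: pvm_domain_def spectral_scale\<close>)
  also have "\<dots> < \<infinity>"
    using u by (simp add: pvm_domain_def ennreal_mult_less_top)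
  finally show ?thesis using u by (simp add: pvm_domain_def)
qed

lemma dom_diff: "u \<in> dom \<Longrightarrow> v \<in> dom \<Longrightarrow> hdiff H u v \<in> dom"
  by (simp add: hdiff_def dom_add dom_scale)

lemma dom_P: 
  assumes "u \<in> dom" "C \<in> sets halfline" shows "P C u \<in> dom"
proof -
  have u: "u \<in> hcarrier H" using assms by (simp add: pvm_domain_def)
  have "(\<integral>\<^sup>+ l. ennreal (l\<^sup>2) \<partial>\<mu> (P C u)) = (\<integral>\<^sup>+ l. indicator C l * ennreal (l\<^sup>2) \<partial>\<mu> u)"
    using assms u by (simp add: spectral_P nn_integral_density)
  also have "\<dots> \<le> (\<integral>\<^sup>+ l. ennreal (l\<^sup>2) \<partial>\<mu> u)"
    by (intro nn_integral_mono) (simp add: indicator_def)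
  finally show ?thesis using assms u by (auto simp: pvm_domain_def)
qed

lemma dom_P_bounded:
  assumes u: "u \<in> hcarrier H" and C: "C \<in> sets halfline" "C \<subseteq> {..K}" shows "P C u \<in> dom"
proof -
  have "C \<subseteq> {0..}" using sets.sets_into_space[OF C(1)] by (simp add: space_restrict_space)
  have "(\<integral>\<^sup>+ l. ennreal (l\<^sup>2) \<partial>\<mu> (P C u)) = (\<integral>\<^sup>+ l. indicator C l * ennreal (l\<^sup>2) \<partial>\<mu> u)"
    using C u by (simp add: spectral_P nn_integral_density)
  also have "\<dots> \<le> (\<integral>\<^sup>+ l. ennreal (K\<^sup>2) \<partial>\<mu> u)"
    using C \<open>C \<subseteq> {0..}\<close> by (intro nn_integral_mono) (auto simp: indicator_def intro!: ennreal_leI power_mono)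
  also have "\<dots> < \<infinity>"
    using finite_measure.emeasure_finite[OF finite_spectral[OF u], of "space (\<mu> u)"]
    by (simp add: ennreal_mult_less_top less_top)
  finally show ?thesis using u C by (auto simp: pvm_domain_def)
qed

text \<open>
  The defining identity of the operator involves a difference of two Lebesgue integrals. When
  the first exceeds the second by a known amount, the extended integrals can be compared
  directly; finiteness on the domain makes the subtraction legitimate.
\<close>

lemma op_inner:
  assumes "(u, w) \<in> op" "v \<in> dom"
    and *: "mean (hadd H u v) = mean (hdiff H u v) + ennreal x" and x: "0 \<le> x"
  shows "hinner H w v = x / 4"
proof -
  have u: "u \<in> dom" using assms by (simp add: pvm_integral_def)
  have int: "(\<integral> l. l \<partial>\<mu> z) = enn2real (mean z)" if "z \<in> dom" for z
    by (rule integral_eq_nn_integral) (auto intro!: AE_I2)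
  have "mean (hdiff H u v) < \<infinity>" using mean_finite dom_diff u assms by simp
  with * x have "enn2real (mean (hadd H u v)) = enn2real (mean (hdiff H u v)) + x"
    by (simp add: enn2real_plus)
  then show ?thesis
    using assms u by (simp add: pvm_integral_def int dom_add dom_diff)
qed

lemma op_carrier: "(u, w) \<in> op \<Longrightarrow> u \<in> dom \<and> u \<in> hcarrier H \<and> w \<in> hcarrier H"
  by (auto simp: pvm_integral_def pvm_domain_def)

lemma halfline_nonneg: "l \<in> space halfline \<Longrightarrow> 0 \<le> l"
  by (simp add: space_restrict_space)

text \<open>
  For \<open>w\<close> the image of \<open>u\<close>, the signed measure \<open>\<langle>P u, w\<rangle>\<close> has density \<open>\<lambda>\<close> with respect to \<open>\<mu> u\<close>.
  The vector to test with is \<open>P C u\<close>: the spectral measures of \<open>u + P C u\<close> and \<open>u - P C u\<close> agree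
  off \<open>C\<close>, and on \<open>C\<close> they are \<open>4 \<mu> u\<close> and \<open>0\<close>.
\<close>

lemma op_form:
  assumes uw: "(u, w) \<in> op" and C: "C \<in> sets halfline"
  shows "(\<integral>\<^sup>+ l. indicator C l * ennreal l \<partial>\<mu> u) = ennreal (form C u w)" and "0 \<le> form C u w"
proof -
  have u: "u \<in> dom" "u \<in> hcarrier H" and w: "w \<in> hcarrier H" using op_carrier[OF uw] by auto
  define J where "J = (\<integral>\<^sup>+ l. indicator C l * ennreal l \<partial>\<mu> u)"
  have "J \<le> mean u" unfolding J_def by (intro nn_integral_mono) (simp add: indicator_def)
  then have J: "J < \<infinity>" using mean_finite[OF u(1)] by (rule le_less_trans)
  have "mean (hadd H u (P C u)) = mean (hdiff H u (P C u)) +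
      (\<integral>\<^sup>+ l. ennreal l \<partial>density (\<mu> u) (\<lambda>l. 4 * indicator C l))"
  proof (rule nn_integral_measure_sum)
    fix X assume "X \<in> sets (\<mu> (hadd H u (P C u)))"
    then have X: "X \<in> sets halfline" by simp
    have "emeasure (density (\<mu> u) (\<lambda>l. 4 * indicator C l)) X = (\<integral>\<^sup>+ l. 4 * indicator (X \<inter> C) l \<partial>\<mu> u)"
      using X C by (simp add: emeasure_density indicator_inter_arith ac_simps)
    also have "\<dots> = 4 * emeasure (\<mu> u) (X \<inter> C)"
      using X C by (subst nn_integral_cmult) simp_all
    also have "\<dots> = ennreal (4 * form (X \<inter> C) u u)"
      using X C u by (simp add: emeasure_spectral ennreal_mult')
    finally have *: "emeasure (density (\<mu> u) (\<lambda>l. 4 * indicator C l)) X = ennreal (4 * form (X \<inter> C) u u)" .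
    have n: "0 \<le> form X (hdiff H u (P C u)) (hdiff H u (P C u))" "0 \<le> form (X \<inter> C) u u"
      using X C u by (auto intro!: form_nonneg)
    have "form X (hadd H u (P C u)) (hadd H u (P C u)) =
        form X (hdiff H u (P C u)) (hdiff H u (P C u)) + 4 * form (X \<inter> C) u u"
      using X C u by (simp add: hdiff_def inf.assoc)
    then show "emeasure (\<mu> (hadd H u (P C u))) X =
        emeasure (\<mu> (hdiff H u (P C u))) X + emeasure (density (\<mu> u) (\<lambda>l. 4 * indicator C l)) X"
      using X C u n by (simp add: emeasure_spectral *)
  qed simp_all
  also have "(\<integral>\<^sup>+ l. ennreal l \<partial>density (\<mu> u) (\<lambda>l. 4 * indicator C l)) = 4 * J"
    using C by (simp add: nn_integral_density mult.assoc nn_integral_cmult J_def)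
  also have "\<dots> = ennreal (4 * enn2real J)"
    using J by (simp add: ennreal_mult' )
  finally have "hinner H w (P C u) = 4 * enn2real J / 4"
    using dom_P[OF u(1) C] by (intro op_inner[OF uw]) simp_all
  then have "form C u w = enn2real J"
    using u w C by (simp add: form_def inner_commute)
  then show "(\<integral>\<^sup>+ l. indicator C l * ennreal l \<partial>\<mu> u) = ennreal (form C u w)" and "0 \<le> form C u w"
    using J by (simp_all add: J_def)
qed

text \<open>
  The second step tests with \<open>v = P A w\<close>. By the first step the spectral measures of \<open>u + v\<close> and
  \<open>u - v\<close> differ by \<open>4 \<langle>P u, w\<rangle>\<close> on \<open>A\<close>, that is, by the measure with density \<open>4 \<lambda>\<close>; integrating \<open>\<lambda>\<close>
  once more gives \<open>\<lambda>\<^sup>2\<close>. Boundedness of \<open>A\<close> ensures that \<open>v\<close> lies in the domain.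
\<close>

lemma op_form_square_bounded:
  assumes uw: "(u, w) \<in> op" and A: "A \<in> sets halfline" "A \<subseteq> {..K}"
  shows "(\<integral>\<^sup>+ l. indicator A l * ennreal (l\<^sup>2) \<partial>\<mu> u) = ennreal (form A w w)"
proof -
  have u: "u \<in> dom" "u \<in> hcarrier H" and w: "w \<in> hcarrier H" using op_carrier[OF uw] by auto
  define v where "v = P A w"
  have v: "v \<in> dom" "v \<in> hcarrier H"
    unfolding v_def using w A by (auto intro: dom_P_bounded)
  define J where "J = (\<integral>\<^sup>+ l. indicator A l * ennreal (l\<^sup>2) \<partial>\<mu> u)"
  have "J \<le> (\<integral>\<^sup>+ l. ennreal (l\<^sup>2) \<partial>\<mu> u)"
    unfolding J_def by (intro nn_integral_mono) (simp add: indicator_def)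
  also have "\<dots> < \<infinity>" using u by (simp add: pvm_domain_def)
  finally have J: "J < \<infinity>" .
  define g where "g l = 4 * (indicator A l * ennreal l)" for l
  have g [measurable]: "g \<in> borel_measurable halfline"
    unfolding g_def using A by measurable
  have "mean (hadd H u v) = mean (hdiff H u v) + (\<integral>\<^sup>+ l. ennreal l \<partial>density (\<mu> u) g)"
  proof (rule nn_integral_measure_sum)
    fix X assume "X \<in> sets (\<mu> (hadd H u v))"
    then have X: "X \<in> sets halfline" by simp
    have "emeasure (density (\<mu> u) g) X = (\<integral>\<^sup>+ l. 4 * (indicator (X \<inter> A) l * ennreal l) \<partial>\<mu> u)"
      using X A by (simp add: emeasure_density g_def indicator_inter_arith ac_simps)
    also have "\<dots> = 4 * (\<integral>\<^sup>+ l. indicator (X \<inter> A) l * ennreal l \<partial>\<mu> u)"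
      using X A by (subst nn_integral_cmult) simp_all
    also have "\<dots> = ennreal (4 * form (X \<inter> A) u w)"
      using X A op_form[OF uw, of "X \<inter> A"] by (simp add: ennreal_mult')
    finally have *: "emeasure (density (\<mu> u) g) X = ennreal (4 * form (X \<inter> A) u w)" .
    have n: "0 \<le> form X (hdiff H u v) (hdiff H u v)" "0 \<le> form (X \<inter> A) u w"
      using X A u v op_form(2)[OF uw, of "X \<inter> A"] by (auto intro!: form_nonneg)
    have "form X (hadd H u v) (hadd H u v) = form X (hdiff H u v) (hdiff H u v) + 4 * form (X \<inter> A) u w"
      using X A u w form_commute[of "X \<inter> A" u w] by (simp add: v_def hdiff_def inf.assoc)
    then show "emeasure (\<mu> (hadd H u v)) X = emeasure (\<mu> (hdiff H u v)) X + emeasure (density (\<mu> u) g) X"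
      using X A u v n by (simp add: emeasure_spectral *)
  qed simp_all
  also have "(\<integral>\<^sup>+ l. ennreal l \<partial>density (\<mu> u) g) = (\<integral>\<^sup>+ l. 4 * (indicator A l * ennreal (l\<^sup>2)) \<partial>\<mu> u)"
    using A by (subst nn_integral_density)
      (auto intro!: nn_integral_cong simp: g_def power2_eq_square ennreal_mult mult.assoc halfline_nonneg)
  also have "\<dots> = 4 * J"
    using A by (simp add: J_def nn_integral_cmult)
  also have "\<dots> = ennreal (4 * enn2real J)"
    using J by (simp add: ennreal_mult')
  finally have "hinner H w v = 4 * enn2real J / 4"
    using v by (intro op_inner[OF uw]) simp_all
  then have "form A w w = enn2real J"
    using w v A by (simp add: form_def v_def inner_commute)
  then show ?thesis using J by (simp add: J_def)
qed

lemma spectral_op: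
  assumes uw: "(u, w) \<in> op"
  shows "\<mu> w = density (\<mu> u) (\<lambda>l. ennreal (l\<^sup>2))"
proof (rule measure_eqI)
  fix A assume "A \<in> sets (\<mu> w)"
  then have A: "A \<in> sets halfline" by simp
  define B where "B n = A \<inter> {..real n}" for n
  have "{0..} \<inter> {..real n} \<in> sets halfline" for n
    by (auto simp: sets_restrict_space)
  then have "A \<inter> ({0..} \<inter> {..real n}) \<in> sets halfline" for n
    using A by (rule sets.Int[rotated])
  moreover have "A \<subseteq> {0..}" using sets.sets_into_space[OF A] by (simp add: space_restrict_space)
  ultimately have B: "B n \<in> sets halfline" for n
    unfolding B_def by (metis Int_absorb2 inf.assoc)
  have inc: "incseq B" by (auto simp: B_def incseq_def)
  have U: "(\<Union>n. B n) = A"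
    using real_arch_simple by (auto simp: B_def)
  have "emeasure (\<mu> w) (B n) = emeasure (density (\<mu> u) (\<lambda>l. ennreal (l\<^sup>2))) (B n)" for n
    using op_form_square_bounded[OF uw B[of n], of "real n"] B[of n] op_carrier[OF uw]
    by (simp add: emeasure_spectral emeasure_density mult.commute) (simp add: B_def)
  then show "emeasure (\<mu> w) A = emeasure (density (\<mu> u) (\<lambda>l. ennreal (l\<^sup>2))) A"
    using SUP_emeasure_incseq[of B "\<mu> w"] SUP_emeasure_incseq[of B "density (\<mu> u) (\<lambda>l. ennreal (l\<^sup>2))"]
      B inc U by (simp add: image_subset_iff)
qed simp

text \<open>
  Adding \<open>u\<close> to its image contributes the cross term \<open>2 \<langle>P u, w\<rangle>\<close>, which is \<open>2 \<lambda>\<close> by \<open>op_form\<close>,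
  and completes \<open>\<lambda>\<^sup>2\<close> to the square \<open>(1 + \<lambda>)\<^sup>2\<close>.
\<close>

lemma spectral_op_plus_id:
  assumes uw: "(u, w) \<in> op"
  shows "\<mu> (hadd H w u) = density (\<mu> u) (\<lambda>l. ennreal ((1 + l)\<^sup>2))"
proof (rule measure_eqI)
  have u: "u \<in> dom" "u \<in> hcarrier H" and w: "w \<in> hcarrier H" using op_carrier[OF uw] by auto
  fix A assume "A \<in> sets (\<mu> (hadd H w u))"
  then have A: "A \<in> sets halfline" by simp
  have pw: "ennreal ((1 + l)\<^sup>2) = ennreal (l\<^sup>2) + 2 * ennreal l + 1" if "0 \<le> l" for l
  proof -
    have "(1 + l)\<^sup>2 = l\<^sup>2 + 2 * l + 1" by (simp add: power2_sum)
    then show ?thesis using that by (simp add: ennreal_mult')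
  qed
  have "emeasure (density (\<mu> u) (\<lambda>l. ennreal ((1 + l)\<^sup>2))) A =
      (\<integral>\<^sup>+ l. ennreal (l\<^sup>2) * indicator A l + 2 * (indicator A l * ennreal l) + indicator A l \<partial>\<mu> u)"
    using A by (subst emeasure_density)
      (auto intro!: nn_integral_cong simp: pw halfline_nonneg split: split_indicator)
  also have "\<dots> = emeasure (density (\<mu> u) (\<lambda>l. ennreal (l\<^sup>2))) A
      + 2 * (\<integral>\<^sup>+ l. indicator A l * ennreal l \<partial>\<mu> u) + emeasure (\<mu> u) A"
    using A by (simp add: nn_integral_add nn_integral_cmult emeasure_density)
  also have "\<dots> = ennreal (form A w w + 2 * form A u w + form A u u)"
    using A u w op_form[OF uw A]
    by (simp add: emeasure_spectral form_nonneg ennreal_mult' flip: spectral_op[OF uw])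
  also have "\<dots> = emeasure (\<mu> (hadd H w u)) A"
    using A u w form_commute[OF A u(2) w] by (simp add: emeasure_spectral algebra_simps)
  finally show "emeasure (\<mu> (hadd H w u)) A = emeasure (density (\<mu> u) (\<lambda>l. ennreal ((1 + l)\<^sup>2))) A" ..
qed simp

end

section \<open>Measures determined by moments\<close>

text \<open>By Weierstrass, a continuous function is uniformly close to a polynomial on the unit interval,
  which carries both measures.\<close>

lemma integral_continuous_eq_if_moments_eq:
  fixes M N :: "real measure" and f :: "real \<Rightarrow> real"
  assumes "finite_measure M" "finite_measure N" and sets [measurable_cong]: "sets M = sets borel" "sets N = sets borel"
    and AE: "AE x in M. x \<in> {0..1}" "AE x in N. x \<in> {0..1}"
    and eq: "\<And>k. (\<integral>x. x ^ k \<partial>M) = (\<integral>x. x ^ k \<partial>N)"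
    and f: "continuous_on UNIV f"
  shows "(\<integral>x. f x \<partial>M) = (\<integral>x. f x \<partial>N)"
proof -
  interpret M: finite_measure M by fact
  interpret N: finite_measure N by fact
  define K where "K = measure M (space M) + measure N (space N)"
  have bnd: "integrable L g" if "finite_measure L" "sets L = sets borel" "AE x in L. x \<in> {0..1}" 
      "continuous_on UNIV g" for L and g :: "real \<Rightarrow> real"
  proof -
    have "continuous_on {0..1::real} g" using that(4) continuous_on_subset by blast
    then have "bounded (g ` {0..1})" by (intro compact_imp_bounded compact_continuous_image) auto
    then obtain B where "\<And>x. x \<in> {0..1} \<Longrightarrow> norm (g x) \<le> B" by (metis bounded_iff imageI)
    moreover have "g \<in> borel_measurable L"
      using borel_measurable_continuous_onI[OF that(4)] that(2) by (simp cong: measurable_cong_sets)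
    ultimately show ?thesis
      using that(3) by (intro finite_measure.integrable_const_bound[OF that(1), of _ B]) auto
  qed
  have close: "\<bar>(\<integral>x. f x \<partial>L) - (\<integral>x. p x \<partial>L)\<bar> \<le> e * measure L (space L)"
    if L: "finite_measure L" "sets L = sets borel" "AE x in L. x \<in> {0..1}" 
      and p: "continuous_on UNIV p" "\<And>x. x \<in> {0..1} \<Longrightarrow> \<bar>f x - p x\<bar> < e" for L p e
  proof -
    interpret finite_measure L by fact
    have "\<bar>(\<integral>x. f x \<partial>L) - (\<integral>x. p x \<partial>L)\<bar> = \<bar>\<integral>x. f x - p x \<partial>L\<bar>"
      using bnd[OF L f] bnd[OF L p(1)] by simp
    also have "\<dots> \<le> (\<integral>x. \<bar>f x - p x\<bar> \<partial>L)" by (rule integral_abs_bound)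
    also have "\<dots> \<le> (\<integral>x. e \<partial>L)"
      using bnd[OF L f] bnd[OF L p(1)] L(3) less_imp_le[OF p(2)] by (intro integral_mono_AE) auto
    finally show ?thesis by (simp add: mult.commute)
  qed
  have "\<bar>(\<integral>x. f x \<partial>M) - (\<integral>x. f x \<partial>N)\<bar> \<le> 0 + e" if "e > 0" for e
  proof -
    have K: "K \<ge> 0" by (simp add: K_def)
    have "0 < e / (K + 1)" using that K by simp
    then obtain p where p: "real_polynomial_function p" "\<And>x. x \<in> {0..1} \<Longrightarrow> \<bar>f x - p x\<bar> < e / (K + 1)"
      using Stone_Weierstrass_real_polynomial_function[OF compact_Icc continuous_on_subset[OF f subset_UNIV]] by metis
    obtain a n where pa: "p = (\<lambda>x. \<Sum>i\<le>n. a i * x ^ i)"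
      using p(1) by (auto simp: real_polynomial_function_iff_sum)
    have pc: "continuous_on UNIV p" unfolding pa by (intro continuous_intros)
    have pow: "continuous_on UNIV (\<lambda>x::real. x ^ k)" for k by (intro continuous_intros)
    have "(\<integral>x. p x \<partial>M) = (\<integral>x. p x \<partial>N)"
      unfolding pa using bnd[OF _ _ AE(1) pow] bnd[OF _ _ AE(2) pow] assms(1,2) sets eq by simp
    moreover have "e / (K + 1) * K \<le> e" using K that by (simp add: field_simps)
    ultimately show ?thesis
      using close[OF assms(1) sets(1) AE(1) pc p(2)] close[OF assms(2) sets(2) AE(2) pc p(2)]
      unfolding K_def by (simp add: distrib_left)
  qed
  then have "\<bar>(\<integral>x. f x \<partial>M) - (\<integral>x. f x \<partial>N)\<bar> \<le> 0" by (rule field_le_epsilon)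
  then show ?thesis by simp
qed

text \<open>The half-lines \<open>{b<..}\<close> generate the Borel sets, and their indicators are monotone limits of
  continuous ramps.\<close>

lemma measure_eq_if_moments_eq:
  fixes M N :: "real measure"
  assumes fin: "finite_measure M" "finite_measure N" and sets [measurable_cong]: "sets M = sets borel" "sets N = sets borel"
    and AE: "AE x in M. x \<in> {0..1}" "AE x in N. x \<in> {0..1}"
    and eq: "\<And>k. (\<integral>x. x ^ k \<partial>M) = (\<integral>x. x ^ k \<partial>N)"
  shows "M = N"
proof -
  interpret M: finite_measure M by fact
  interpret N: finite_measure N by fact
  define \<phi> where "\<phi> b n x = min 1 (max 0 (real n * (x - b)))" for b x :: real and n
  have \<phi>_lim: "(\<lambda>n. \<phi> b n x) \<longlonglongrightarrow> indicator {b<..} x" for b x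
  proof (cases "x > b")
    case True
    obtain m where m: "1 < real m * (x - b)" using reals_Archimedean3[of "x - b"] True by (metis diff_gt_0_iff_gt)
    have "eventually (\<lambda>n. \<phi> b n x = indicator {b<..} x) sequentially"
      using eventually_ge_at_top[of m]
    proof eventually_elim
      case (elim n)
      have "real m * (x - b) \<le> real n * (x - b)" using elim True by (intro mult_right_mono) auto
      then have "1 < real n * (x - b)" using m by linarith
      then show ?case using True by (simp add: \<phi>_def)
    qed
    then show ?thesis by (rule tendsto_eventually)
  next
    case False
    then have "real n * (x - b) \<le> 0" for n by (simp add: mult_nonneg_nonpos)
    then have "\<phi> b n x = 0" for n by (simp add: \<phi>_def max_absorb1)
    then show ?thesis using False by simp
  qed
  have lim: "(\<lambda>n. \<integral>x. \<phi> b n x \<partial>L) \<longlonglongrightarrow> measure L {b<..}" if "finite_measure L" "sets L = sets borel" for L b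
  proof -
    interpret finite_measure L by fact
    have "(\<lambda>n. \<integral>x. \<phi> b n x \<partial>L) \<longlonglongrightarrow> (\<integral>x. indicator {b<..} x \<partial>L)"
    proof (rule integral_dominated_convergence[where w = "\<lambda>_. 1"])
      show "\<phi> b n \<in> borel_measurable L" for n
        unfolding \<phi>_def using that(2) by (simp cong: measurable_cong_sets)
      show "AE x in L. norm (\<phi> b n x) \<le> 1" for n by (rule AE_I2) (simp add: \<phi>_def)
    qed (use \<phi>_lim that(2) in \<open>auto cong: measurable_cong_sets\<close>)
    also have "(\<integral>x. indicator {b<..} x \<partial>L) = measure L {b<..}"
      using that(2) sets_eq_imp_space_eq[OF that(2)] by simp
    finally show ?thesis .
  qed
  have "(\<integral>x. \<phi> b n x \<partial>M) = (\<integral>x. \<phi> b n x \<partial>N)" for b n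
    by (rule integral_continuous_eq_if_moments_eq[OF assms]) (auto simp: \<phi>_def intro!: continuous_intros)
  then have "measure M {b<..} = measure N {b<..}" for b
    using lim[OF fin(1) sets(1)] lim[OF fin(2) sets(2)] LIMSEQ_unique by fastforce
  then show ?thesis
    by (intro measure_eqI_lessThan sets) (auto simp: M.emeasure_eq_measure N.emeasure_eq_measure)
qed

text \<open>
  The substitution \<open>y = 1 / (1 + l)\<^sup>2\<close> is injective on the half-line and maps it into the unit
  interval, which turns the integrals of powers of the squared resolvent into moments.
\<close>

lemma measure_eq_if_resolvent_moments_eq:
  fixes M N :: "real measure"
  assumes fin: "finite_measure M" "finite_measure N" and sets [measurable_cong]: "sets M = sets halfline" "sets N = sets halfline"
    and eq: "\<And>k. (\<integral>\<^sup>+ l. ennreal (1 / (1 + l)\<^sup>2) ^ k \<partial>M) = (\<integral>\<^sup>+ l. ennreal (1 / (1 + l)\<^sup>2) ^ k \<partial>N)"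
  shows "M = N"
proof -
  define y where "y l = 1 / (1 + l)\<^sup>2" for l :: real
  \<comment> \<open>inverse of \<open>y\<close> on its range; the maximum only forces values in the half-line elsewhere\<close>
  define g where "g s = max 0 (1 / sqrt s - 1)" for s :: real
  have y_m: "y \<in> borel_measurable halfline"
    unfolding y_def by (rule measurable_restrict_space1) measurable
  have g_m: "g \<in> measurable borel halfline"
    unfolding g_def by (rule measurable_restrict_space2) auto
  have push: "finite_measure (distr L borel y)" "AE s in distr L borel y. s \<in> {0..1}"
      "(\<integral>s. s ^ k \<partial>distr L borel y) = enn2real (\<integral>\<^sup>+ l. ennreal (1 / (1 + l)\<^sup>2) ^ k \<partial>L)"
      "distr (distr L borel y) halfline g = L"
    if L: "finite_measure L" "sets L = sets halfline" for L k
  proof -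
    have sp: "space L = {0..}"
      using sets_eq_imp_space_eq[OF L(2)] by (simp add: space_restrict_space)
    have y: "y \<in> borel_measurable L" using y_m L(2) by (simp cong: measurable_cong_sets)
    show "finite_measure (distr L borel y)" by (rule finite_measure.finite_measure_distr[OF L(1) y])
    have "y l \<in> {0..1}" if "l \<in> space L" for l
      using that by (simp add: y_def sp field_simps one_le_power)
    then have "AE l in L. y l \<in> {0..1}" by (intro AE_I2)
    then show "AE s in distr L borel y. s \<in> {0..1}"
      by (subst AE_distr_iff[OF y]) auto
    have "(\<integral>s. s ^ k \<partial>distr L borel y) = (\<integral>l. y l ^ k \<partial>L)"
      by (rule integral_distr[OF y]) simp
    also have "\<dots> = enn2real (\<integral>\<^sup>+ l. ennreal (y l ^ k) \<partial>L)"
    proof (rule integral_eq_nn_integral)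
      show "(\<lambda>l. y l ^ k) \<in> borel_measurable L" using y by measurable
    qed (simp add: y_def)
    finally show "(\<integral>s. s ^ k \<partial>distr L borel y) = enn2real (\<integral>\<^sup>+ l. ennreal (1 / (1 + l)\<^sup>2) ^ k \<partial>L)"
      by (simp add: y_def ennreal_power)
    have "distr (distr L borel y) halfline g = distr L halfline (g \<circ> y)"
      by (rule distr_distr[OF g_m y])
    also have "\<dots> = distr L halfline (\<lambda>l. l)"
      by (rule distr_cong) (auto simp: sp y_def g_def real_sqrt_divide)
    also have "\<dots> = L" by (rule distr_id2[OF L(2)[symmetric]])
    finally show "distr (distr L borel y) halfline g = L" .
  qed
  have "distr M borel y = distr N borel y"
    by (rule measure_eq_if_moments_eq) (use push fin sets eq in simp_all)
  then show ?thesis using push(4)[OF fin(1) sets(1)] push(4)[OF fin(2) sets(2)] by metis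
qed

section \<open>Square summable functions\<close>

lemma square_summable_mult:
  assumes "f \<in> hcarrier ell2" "g \<in> hcarrier ell2"
  shows "(\<lambda>x. f x * g x) summable_on UNIV"
proof -
  have "(\<lambda>x. (f x)\<^sup>2 + (g x)\<^sup>2) summable_on UNIV"
    using assms by (intro summable_on_add) (simp_all add: ell2_def)
  then have "(\<lambda>x. norm (f x * g x)) summable_on UNIV"
  proof (rule Infinite_Sum.abs_summable_on_comparison_test')
    fix x
    have "0 \<le> (\<bar>f x\<bar> - \<bar>g x\<bar>)\<^sup>2 + \<bar>f x\<bar>\<^sup>2 + \<bar>g x\<bar>\<^sup>2" by simp
    then show "norm (f x * g x) \<le> (f x)\<^sup>2 + (g x)\<^sup>2"
      by (simp add: power2_diff abs_mult)
  qed
  then show ?thesis by (subst summable_on_iff_abs_summable_on_real)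
qed

lemma ell2_carrier: "f \<in> hcarrier ell2 \<longleftrightarrow> (\<lambda>x. (f x)\<^sup>2) summable_on UNIV"
  by (simp add: ell2_def)

lemma ell2_add:
  assumes f: "f \<in> hcarrier ell2" and g: "g \<in> hcarrier ell2"
  shows "(\<lambda>x. f x + g x) \<in> hcarrier ell2"
proof -
  have "(\<lambda>x. ((f x)\<^sup>2 + (g x)\<^sup>2) + 2 * (f x * g x)) summable_on UNIV"
    using f g square_summable_mult[OF f g] unfolding ell2_carrier
    by (intro summable_on_add summable_on_cmult_right)
  then show ?thesis unfolding ell2_carrier power2_sum by (simp only: mult.assoc)
qed

lemma ell2_scale: "f \<in> hcarrier ell2 \<Longrightarrow> (\<lambda>x. a * f x) \<in> hcarrier ell2"
  unfolding ell2_carrier power_mult_distrib by (rule summable_on_cmult_right)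

lemma ell2_ops [simp]:
  "hadd ell2 f g = (\<lambda>x. f x + g x)" "hscale ell2 a f = (\<lambda>x. a * f x)"
  "hdiff ell2 f g = (\<lambda>x. f x - g x)"
  by (simp_all add: ell2_def hdiff_def)

interpretation ell2: inner_space "ell2 :: ('i \<Rightarrow> real) hspace"
proof
  fix u v z :: "'i \<Rightarrow> real" and a :: real
  assume u: "u \<in> hcarrier ell2"
  show "hscale ell2 a u \<in> hcarrier ell2" using u by (simp add: ell2_scale)
  show "0 \<le> hinner ell2 u u" by (simp add: ell2_def infsum_nonneg)
  { assume "v \<in> hcarrier ell2"
    then show "hadd ell2 u v \<in> hcarrier ell2" using u by (simp add: ell2_add) }
  show "hinner ell2 u v = hinner ell2 v u" by (simp add: ell2_def mult.commute)
  { assume z: "z \<in> hcarrier ell2"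
    show "hinner ell2 (hscale ell2 a u) z = a * hinner ell2 u z"
      using infsum_cmult_right[OF square_summable_mult[OF u z], of a] by (simp add: ell2_def mult.assoc)
    assume v: "v \<in> hcarrier ell2"
    show "hinner ell2 (hadd ell2 u v) z = hinner ell2 u z + hinner ell2 v z"
      using infsum_add[OF square_summable_mult[OF u z] square_summable_mult[OF v z]]
      by (simp add: ell2_def distrib_right) }
qed

lemma ell2_sum_le:
  assumes "f \<in> hcarrier ell2" "finite F"
  shows "(\<Sum>x\<in>F. (f x)\<^sup>2) \<le> hinner ell2 f f"
  using assms finite_sum_le_infsum[of "\<lambda>x. (f x)\<^sup>2" UNIV F] by (simp add: ell2_def power2_eq_square)

lemma ell2_bound:
  assumes "\<And>F. finite F \<Longrightarrow> (\<Sum>x\<in>F. (f x)\<^sup>2) \<le> b"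
  shows "f \<in> hcarrier ell2" and "hinner ell2 f f \<le> b"
proof -
  show "f \<in> hcarrier ell2"
    using assms by (auto simp: ell2_def intro!: nonneg_bdd_above_summable_on bdd_aboveI2[where M = b])
  then show "hinner ell2 f f \<le> b"
    using assms infsum_le_finite_sums[of "\<lambda>x. (f x)\<^sup>2" UNIV b] by (simp add: ell2_def power2_eq_square)
qed

lemma ell2_coordinate_le: "f \<in> hcarrier ell2 \<Longrightarrow> (f x)\<^sup>2 \<le> hinner ell2 f f"
  using ell2_sum_le[of f "{x}"] by simp

text \<open>
  Projection onto a convex set, midpoints being all of convexity that the argument uses. By the
  parallelogram law a minimizing sequence is Cauchy, hence it converges pointwise, and Fatou's
  argument on finite sets shows that the pointwise limit is square summable and is the limit in
  norm. The density of a subspace is read off from the sequence itself, whereas sets given by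
  pointwise conditions contain the limit \<open>l\<close>, which is then a minimizer.
\<close>

lemma ell2_minimizing_sequence:
  assumes K: "K \<subseteq> hcarrier ell2" "K \<noteq> {}"
    and mid: "\<And>f g. f \<in> K \<Longrightarrow> g \<in> K \<Longrightarrow> (\<lambda>x. (f x + g x) / 2) \<in> K"
  shows "\<exists>d f l. (\<forall>g\<in>K. d \<le> hinner ell2 g g) \<and> (\<forall>n::nat. f n \<in> K) \<and>
    (\<lambda>n. hinner ell2 (f n) (f n)) \<longlonglongrightarrow> d \<and> (\<forall>x. (\<lambda>n. f n x) \<longlonglongrightarrow> l x) \<and>
    l \<in> hcarrier ell2 \<and> hinner ell2 l l \<le> d \<and>
    (\<lambda>n. hinner ell2 (\<lambda>x. f n x - l x) (\<lambda>x. f n x - l x)) \<longlonglongrightarrow> 0"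
proof -
  let ?N = "\<lambda>f. hinner ell2 f f"
  define d where "d = (INF g\<in>K. ?N g)"
  have bdd: "bdd_below (?N ` K)"
    using K(1) ell2.inner_nonneg by (intro bdd_belowI2[of _ 0]) blast
  have d: "d \<le> ?N g" if "g \<in> K" for g
    unfolding d_def using bdd that by (rule cINF_lower)
  have "\<exists>g\<in>K. ?N g < d + 1 / Suc n" for n
    using cINF_less_iff[OF K(2) bdd, of "d + 1 / Suc n"] by (simp add: d_def)
  then obtain f where f: "\<And>n. f n \<in> K" "\<And>n. ?N (f n) < d + 1 / Suc n" by metis
  have fc: "f n \<in> hcarrier ell2" for n using f(1) K(1) by blast
  have lim0: "(\<lambda>n. b / Suc n) \<longlonglongrightarrow> 0" for b :: real
    using tendsto_mult_right_zero[OF LIMSEQ_inverse_real_of_nat, of b] by (simp add: field_simps)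
  have Nd: "(\<lambda>n. ?N (f n)) \<longlonglongrightarrow> d"
  proof (rule tendsto_sandwich[of "\<lambda>_. d" _ _ "\<lambda>n. d + 1 / Suc n"])
    show "(\<lambda>n. d + 1 / Suc n) \<longlonglongrightarrow> d" using tendsto_add[OF tendsto_const lim0] by simp
  qed (use d f in \<open>auto intro!: always_eventually less_imp_le\<close>)
  have close: "?N (\<lambda>x. f n x - f m x) \<le> 2 / Suc n + 2 / Suc m" for n m
  proof -
    have "?N (\<lambda>x. (f n x + f m x) / 2) = ?N (hscale ell2 (1/2) (hadd ell2 (f n) (f m)))" by simp
    also have "\<dots> = (?N (f n) + 2 * hinner ell2 (f n) (f m) + ?N (f m)) / 4"
      using fc ell2.inner_commute[OF fc fc] by (simp del: ell2_ops add: algebra_simps)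
    finally have 1: "4 * d \<le> ?N (f n) + 2 * hinner ell2 (f n) (f m) + ?N (f m)"
      using d[OF mid[OF f(1) f(1)], of n m] by simp
    have "?N (\<lambda>x. f n x - f m x) = ?N (hdiff ell2 (f n) (f m))" by simp
    also have "\<dots> = ?N (f n) - 2 * hinner ell2 (f n) (f m) + ?N (f m)"
      using fc ell2.inner_commute[OF fc fc] by (simp del: ell2_ops add: hdiff_def)
    finally show ?thesis using 1 f(2)[of n] f(2)[of m] by simp
  qed
  have diffc: "(\<lambda>x. f n x - f m x) \<in> hcarrier ell2" for n m
    using ell2.diff_closed[OF fc fc, of n m] by simp
  have "Cauchy (\<lambda>n. f n x)" for x
  proof (rule metric_CauchyI)
    fix e :: real assume e: "e > 0"
    obtain N where N: "4 / e\<^sup>2 < real N" using reals_Archimedean2 by blast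
    have small: "2 / real (Suc k) < e\<^sup>2 / 2" if "k \<ge> N" for k
    proof -
      have "real N < real (Suc k)" using that by simp
      with N have "4 / e\<^sup>2 < real (Suc k)" by (rule less_trans)
      then have "4 < real (Suc k) * e\<^sup>2" using e by (simp add: pos_divide_less_eq del: of_nat_Suc)
      then show ?thesis by (simp add: field_simps del: of_nat_Suc)
    qed
    have "dist (f m x) (f n x) < e" if "m \<ge> N" "n \<ge> N" for m n
    proof -
      have "2 / real (Suc m) + 2 / real (Suc n) < e\<^sup>2 / 2 + e\<^sup>2 / 2"
        by (rule add_strict_mono[OF small[OF that(1)] small[OF that(2)]])
      also have "\<dots> = e\<^sup>2" by simp
      finally have "?N (\<lambda>x. f m x - f n x) < e\<^sup>2" using close[of m n] by (rule le_less_trans[rotated])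
      then have "(f m x - f n x)\<^sup>2 < e\<^sup>2" using ell2_coordinate_le[OF diffc, where x = x] by (rule le_less_trans[rotated])
      then have "\<bar>f m x - f n x\<bar>\<^sup>2 < e\<^sup>2" by simp
      then show ?thesis unfolding dist_real_def by (rule power2_less_imp_less) (use e in simp)
    qed
    then show "\<exists>M. \<forall>m\<ge>M. \<forall>n\<ge>M. dist (f m x) (f n x) < e" by blast
  qed
  then have "\<exists>l. (\<lambda>n. f n x) \<longlonglongrightarrow> l" for x
    by (simp add: Cauchy_convergent_iff convergent_def)
  then obtain l where l: "\<And>x. (\<lambda>n. f n x) \<longlonglongrightarrow> l x" by metis
  have diff: "(\<Sum>x\<in>F. (f n x - l x)\<^sup>2) \<le> 2 / Suc n" if "finite F" for F n
  proof (rule LIMSEQ_le)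
    show "(\<lambda>m. \<Sum>x\<in>F. (f n x - f m x)\<^sup>2) \<longlonglongrightarrow> (\<Sum>x\<in>F. (f n x - l x)\<^sup>2)"
      by (intro tendsto_intros l)
    show "(\<lambda>m. 2 / Suc n + 2 / Suc m) \<longlonglongrightarrow> 2 / Suc n"
      using tendsto_add[OF tendsto_const lim0[of 2], of "2 / Suc n"] by simp
    show "\<exists>N. \<forall>m\<ge>N. (\<Sum>x\<in>F. (f n x - f m x)\<^sup>2) \<le> 2 / Suc n + 2 / Suc m"
      using ell2_sum_le[OF diffc that] close order_trans by blast
  qed
  have bl: "(\<Sum>x\<in>F. (l x)\<^sup>2) \<le> d" if "finite F" for F
  proof (rule LIMSEQ_le)
    show "(\<lambda>m. \<Sum>x\<in>F. (f m x)\<^sup>2) \<longlonglongrightarrow> (\<Sum>x\<in>F. (l x)\<^sup>2)"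
      by (intro tendsto_intros l)
    show "\<exists>N. \<forall>m\<ge>N. (\<Sum>x\<in>F. (f m x)\<^sup>2) \<le> ?N (f m)"
      using ell2_sum_le[OF fc that] by blast
  qed (rule Nd)
  have "(\<lambda>n. ?N (\<lambda>x. f n x - l x)) \<longlonglongrightarrow> 0"
  proof (rule tendsto_sandwich[of "\<lambda>_. 0" _ _ "\<lambda>n. 2 / Suc n"])
    show "(\<lambda>n. 2 / Suc n) \<longlonglongrightarrow> (0::real)" by (rule lim0)
  qed (use ell2_bound[OF diff] ell2.inner_nonneg in \<open>auto intro!: always_eventually\<close>)
  then show ?thesis
    using d f(1) Nd l ell2_bound[OF bl] by (intro exI[of _ d] exI[of _ f] exI[of _ l]) auto
qed

lemma infsum_eq_sum:
  fixes f :: "'a \<Rightarrow> real"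
  assumes "finite S" "\<And>x. x \<notin> S \<Longrightarrow> f x = 0"
  shows "infsum f UNIV = sum f S"
  using infsum_cong_neutral[of UNIV S f f] assms by auto

lemma summable_on_finite_support:
  fixes f :: "'a \<Rightarrow> real"
  assumes "finite S" "\<And>x. x \<notin> S \<Longrightarrow> f x = 0"
  shows "f summable_on UNIV"
  using summable_on_cong_neutral[of UNIV S f f] assms by auto

lemma ell2_inner: "hinner ell2 f g = infsum (\<lambda>x. f x * g x) UNIV"
  by (simp add: ell2_def)

text \<open>The first-order condition at the minimum of a quadratic function of \<open>s\<close>.\<close>

lemma linear_term_vanishes:
  fixes a b :: real
  assumes "\<And>s. 0 \<le> 2 * s * b + s\<^sup>2 * a"
  shows "b = 0"
proof (rule ccontr)
  assume b: "b \<noteq> 0"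
  have a: "0 \<le> a" using assms[of 1] assms[of "-1"] by simp
  \<comment> \<open>a point near the minimizer \<open>- b / a\<close> that also makes sense for \<open>a = 0\<close>\<close>
  have "2 * (- b / (a + 1)) * b + (- b / (a + 1))\<^sup>2 * a = b\<^sup>2 / (a + 1)\<^sup>2 * (- a - 2)"
    using a by (simp add: power2_eq_square divide_simps) (simp add: algebra_simps)
  moreover have "b\<^sup>2 / (a + 1)\<^sup>2 * (- a - 2) < 0"
    using a b by (intro mult_pos_neg) (auto intro!: divide_pos_pos)
  ultimately show False using assms[of "- b / (a + 1)"] by simp
qed

section \<open>The energy space\<close>

locale conductance =
  fixes c :: "'v \<Rightarrow> 'v \<Rightarrow> real"
  assumes network: "network c"
begin

lemma
  shows c_nonneg: "0 \<le> c x y" and c_sym: "c x y = c y x"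
    and finite_nbrs [simp]: "finite {y. 0 < c x y}"
    and connected: "(x, y) \<in> {(a, b). 0 < c a b}\<^sup>*"
  using network by (auto simp: network_def)

abbreviation E :: "('v \<Rightarrow> real) set hspace" where
  "E \<equiv> energy_space c"

text \<open>
  Up to the factor \<open>2\<close> that comes from counting each edge twice, the energy is the square norm of
  the gradient, so the geometry of the energy space is inherited from square summable functions
  on pairs of vertices.
\<close>

definition grad :: "('v \<Rightarrow> real) \<Rightarrow> 'v \<times> 'v \<Rightarrow> real" where
  "grad u = (\<lambda>(x, y). sqrt (c x y) * (u x - u y))"

lemma grad_mult: "grad u (x, y) * grad v (x, y) = c x y * (u x - u y) * (v x - v y)"
proof -
  have "sqrt (c x y) * sqrt (c x y) = c x y" by (simp add: c_nonneg)
  then show ?thesis by (simp add: grad_def algebra_simps)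
qed

lemma dom_energy_iff: "u \<in> dom_energy c \<longleftrightarrow> grad u \<in> hcarrier ell2"
proof -
  have "(\<lambda>(x, y). c x y * (u x - u y)\<^sup>2) = (\<lambda>p. (grad u p)\<^sup>2)"
    using grad_mult[of u _ _ u] by (auto simp: fun_eq_iff power2_eq_square mult.assoc)
  then show ?thesis by (simp add: dom_energy_def ell2_carrier)
qed

lemma energy_grad: "energy c u v = hinner ell2 (grad u) (grad v) / 2"
proof -
  have "(\<lambda>(x, y). c x y * (u x - u y) * (v x - v y)) = (\<lambda>p. grad u p * grad v p)"
    using grad_mult[of u _ _ v] by (auto simp: fun_eq_iff)
  then show ?thesis by (simp add: energy_def ell2_inner)
qed

lemma grad_add: "grad (\<lambda>x. u x + v x) = hadd ell2 (grad u) (grad v)"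
  and grad_scale: "grad (\<lambda>x. a * u x) = hscale ell2 a (grad u)"
  by (auto simp: grad_def fun_eq_iff algebra_simps)

lemma dom_energy_add: "u \<in> dom_energy c \<Longrightarrow> v \<in> dom_energy c \<Longrightarrow> (\<lambda>x. u x + v x) \<in> dom_energy c"
  unfolding dom_energy_iff grad_add by (rule ell2.add_closed)

lemma dom_energy_scale: "u \<in> dom_energy c \<Longrightarrow> (\<lambda>x. a * u x) \<in> dom_energy c"
  unfolding dom_energy_iff grad_scale by (rule ell2.scale_closed)

lemma dom_energy_diff: "u \<in> dom_energy c \<Longrightarrow> v \<in> dom_energy c \<Longrightarrow> (\<lambda>x. u x - v x) \<in> dom_energy c"
  using dom_energy_add[OF _ dom_energy_scale[of v "-1"], of u] by simp

lemma energy_commute: "energy c u v = energy c v u"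
  by (simp add: energy_grad ell2_inner mult.commute)

lemma energy_add: "u \<in> dom_energy c \<Longrightarrow> v \<in> dom_energy c \<Longrightarrow> w \<in> dom_energy c \<Longrightarrow>
    energy c (\<lambda>x. u x + v x) w = energy c u w + energy c v w"
  unfolding energy_grad grad_add dom_energy_iff by (simp del: ell2_ops)

lemma energy_scale: "u \<in> dom_energy c \<Longrightarrow> w \<in> dom_energy c \<Longrightarrow>
    energy c (\<lambda>x. a * u x) w = a * energy c u w"
  unfolding energy_grad grad_scale dom_energy_iff by (simp del: ell2_ops)

lemma energy_diff: "u \<in> dom_energy c \<Longrightarrow> v \<in> dom_energy c \<Longrightarrow> w \<in> dom_energy c \<Longrightarrow>
    energy c (\<lambda>x. u x - v x) w = energy c u w - energy c v w"
  using energy_add[OF _ dom_energy_scale[of v "-1"], of u w] energy_scale[of v w "-1"] by simp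

lemma energy_square_add:
  assumes u: "u \<in> dom_energy c" and v: "v \<in> dom_energy c"
  shows "energy c (\<lambda>x. u x + v x) (\<lambda>x. u x + v x) = energy c u u + 2 * energy c u v + energy c v v"
proof -
  let ?w = "\<lambda>x. u x + v x"
  have "energy c ?w ?w = energy c u ?w + energy c v ?w"
    using u v dom_energy_add by (intro energy_add)
  also have "energy c u ?w = energy c u u + energy c v u"
    using u v by (subst energy_commute) (rule energy_add)
  also have "energy c v ?w = energy c u v + energy c v v"
    using u v by (subst energy_commute) (rule energy_add)
  finally show ?thesis using energy_commute[of u v] by simp
qed

lemma energy_square_scale:
  assumes u: "u \<in> dom_energy c"
  shows "energy c (\<lambda>x. a * u x) (\<lambda>x. a * u x) = a\<^sup>2 * energy c u u"
proof -
  have "energy c (\<lambda>x. a * u x) (\<lambda>x. a * u x) = a * energy c u (\<lambda>x. a * u x)"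
    using u dom_energy_scale by (intro energy_scale)
  also have "energy c u (\<lambda>x. a * u x) = a * energy c u u"
    using u by (subst energy_commute) (rule energy_scale)
  finally show ?thesis by (simp add: power2_eq_square)
qed

lemma energy_square_diff:
  assumes u: "u \<in> dom_energy c" and v: "v \<in> dom_energy c"
  shows "energy c (\<lambda>x. u x - v x) (\<lambda>x. u x - v x) = energy c u u - 2 * energy c u v + energy c v v"
  using energy_square_add[OF u dom_energy_scale[OF v], of "-1"] energy_square_scale[OF v, of "-1"]
    energy_scale[OF v u, of "-1"] energy_commute[of u "\<lambda>x. -1 * v x"] energy_commute[of u v] by simp

lemma energy_nonneg: "u \<in> dom_energy c \<Longrightarrow> 0 \<le> energy c u u"
  unfolding energy_grad dom_energy_iff by (simp add: ell2.inner_nonneg)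

lemma dom_energy_sum:
  "finite F \<Longrightarrow> (\<And>x. x \<in> F \<Longrightarrow> f x \<in> dom_energy c) \<Longrightarrow> (\<lambda>z. \<Sum>x\<in>F. a x * f x z) \<in> dom_energy c"
proof (induction F rule: finite_induct)
  case empty
  then show ?case by (simp add: dom_energy_def split_def)
qed (auto intro!: dom_energy_add dom_energy_scale)

lemma energy_sum:
  assumes w: "w \<in> dom_energy c"
  shows "finite F \<Longrightarrow> (\<And>x. x \<in> F \<Longrightarrow> f x \<in> dom_energy c) \<Longrightarrow>
    energy c (\<lambda>z. \<Sum>x\<in>F. a x * f x z) w = (\<Sum>x\<in>F. a x * energy c (f x) w)"
proof (induction F rule: finite_induct)
  case empty
  then show ?case by (simp add: energy_def split_def)
next
  case (insert x F)
  have "energy c (\<lambda>z. a x * f x z + (\<Sum>x\<in>F. a x * f x z)) w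
      = energy c (\<lambda>z. a x * f x z) w + energy c (\<lambda>z. \<Sum>x\<in>F. a x * f x z) w"
    using insert w by (intro energy_add dom_energy_scale dom_energy_sum) auto
  then show ?case using insert w by (simp add: energy_scale)
qed

lemma constant_if_equal_on_edges:
  assumes "\<And>x y. 0 < c x y \<Longrightarrow> u x = u y"
  shows "u x = u y"
  using connected[of x y] by (induction rule: rtrancl_induct) (use assms in auto)

lemma constant_if_energy_zero:
  assumes u: "u \<in> dom_energy c" and e: "energy c u u \<le> 0"
  shows "u x = u y"
proof (rule constant_if_equal_on_edges)
  fix a b assume ab: "0 < c a b"
  have "(grad u (a, b))\<^sup>2 \<le> 0"
    using ell2_coordinate_le[of "grad u" "(a, b)"] u e unfolding dom_energy_iff energy_grad by linarith
  then show "u a = u b" using ab by (simp add: grad_def)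
qed

subsection \<open>Classes modulo constants\<close>

lemma const_class_eq_iff: "const_class u = const_class v \<longleftrightarrow> (\<exists>k. \<forall>x. u x = v x + k)"
proof
  assume "const_class u = const_class v"
  moreover have "u \<in> const_class u" by (auto simp: const_class_def intro!: exI[of _ 0])
  ultimately show "\<exists>k. \<forall>x. u x = v x + k" by (simp add: const_class_def)
next
  assume "\<exists>k. \<forall>x. u x = v x + k"
  then obtain k where k: "\<And>x. u x = v x + k" by blast
  have "(\<exists>j. \<forall>x. w x = u x + j) \<longleftrightarrow> (\<exists>j. \<forall>x. w x = v x + j)" for w
  proof
    assume "\<exists>j. \<forall>x. w x = u x + j"
    then obtain j where "\<And>x. w x = u x + j" by blast
    then show "\<exists>j. \<forall>x. w x = v x + j" by (intro exI[of _ "k + j"]) (simp add: k)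
  next
    assume "\<exists>j. \<forall>x. w x = v x + j"
    then obtain j where "\<And>x. w x = v x + j" by blast
    then show "\<exists>j. \<forall>x. w x = u x + j" by (intro exI[of _ "j - k"]) (simp add: k)
  qed
  then show "const_class u = const_class v" by (simp add: const_class_def)
qed

lemma rep_class: obtains k where "rep (const_class u) = (\<lambda>x. u x + k)"
  using rep_const_class[of u] by auto

lemma E_add: "hadd E (const_class u) (const_class v) = const_class (\<lambda>x. u x + v x)"
proof -
  obtain j k where "rep (const_class u) = (\<lambda>x. u x + j)" "rep (const_class v) = (\<lambda>x. v x + k)"
    by (metis rep_class)
  then show ?thesis by (simp add: energy_space_def const_class_eq_iff)
qed

lemma E_scale: "hscale E a (const_class u) = const_class (\<lambda>x. a * u x)"
proof -
  obtain k where "rep (const_class u) = (\<lambda>x. u x + k)" by (metis rep_class)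
  then show ?thesis by (simp add: energy_space_def const_class_eq_iff) (metis distrib_left)
qed

lemma E_carrier: "hcarrier E = const_class ` dom_energy c"
  by (simp add: energy_space_def)

lemma E_inner: "hinner E U V = energy c (rep U) (rep V)"
  by (simp add: energy_space_def)

lemma class_rep: "U \<in> hcarrier E \<Longrightarrow> const_class (rep U) = U"
  using rep_const_class by (auto simp: E_carrier intro!: const_class_eq_iff[THEN iffD2])

lemma rep_dom_energy: "U \<in> hcarrier E \<Longrightarrow> rep U \<in> dom_energy c"
proof -
  assume "U \<in> hcarrier E"
  then obtain u where u: "u \<in> dom_energy c" "U = const_class u" by (auto simp: E_carrier)
  obtain k where "rep U = (\<lambda>x. u x + k)" using u rep_class by metis
  then show ?thesis using u by (simp add: dom_energy_def)
qed

lemma class_carrier: "u \<in> dom_energy c \<Longrightarrow> const_class u \<in> hcarrier E"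
  by (simp add: E_carrier)

lemma inner_space_E: "inner_space E"
proof
  fix U V Z a assume "U \<in> hcarrier E"
  then obtain u where u: "u \<in> dom_energy c" "U = const_class u" by (auto simp: E_carrier)
  show "hscale E a U \<in> hcarrier E"
    using u by (simp add: E_scale class_carrier dom_energy_scale)
  show "0 \<le> hinner E U U" using u by (simp add: hinner_energy_space energy_nonneg)
  { assume "V \<in> hcarrier E"
    then obtain v where v: "v \<in> dom_energy c" "V = const_class v" by (auto simp: E_carrier)
    show "hadd E U V \<in> hcarrier E"
      using u v by (simp add: E_add class_carrier dom_energy_add) }
  show "hinner E U V = hinner E V U" by (simp add: E_inner energy_commute)
  { assume Z: "Z \<in> hcarrier E"
    then obtain z where z: "z \<in> dom_energy c" "Z = const_class z" by (auto simp: E_carrier)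
    show "hinner E (hscale E a U) Z = a * hinner E U Z"
      using u z by (simp add: E_scale hinner_energy_space energy_scale)
    assume "V \<in> hcarrier E"
    then obtain v where v: "v \<in> dom_energy c" "V = const_class v" by (auto simp: E_carrier)
    show "hinner E (hadd E U V) Z = hinner E U Z + hinner E V Z"
      using u v z by (simp add: E_add hinner_energy_space energy_add) }
qed

lemma class_eq_if_energy_zero:
  assumes "u \<in> dom_energy c" "v \<in> dom_energy c" "energy c (\<lambda>x. u x - v x) (\<lambda>x. u x - v x) \<le> 0"
  shows "const_class u = const_class v"
proof -
  obtain x0 :: 'v where True by blast
  have "u x - v x = u x0 - v x0" for x
    using constant_if_energy_zero[OF dom_energy_diff[OF assms(1,2)] assms(3)] .
  then have "\<forall>x. u x = v x + (u x0 - v x0)" by (metis add.commute diff_add_cancel)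
  then show ?thesis unfolding const_class_eq_iff by blast
qed

subsection \<open>Green's identity\<close>

lemma laplacian_add: "laplacian c (\<lambda>z. u z + v z) y = laplacian c u y + laplacian c v y"
  unfolding laplacian_def by (subst sum.distrib[symmetric]) (simp add: algebra_simps)

lemma laplacian_scale: "laplacian c (\<lambda>z. a * u z) y = a * laplacian c u y"
  unfolding laplacian_def by (subst sum_distrib_left) (simp add: algebra_simps)

lemma laplacian_sum:
  "finite F \<Longrightarrow> laplacian c (\<lambda>z. \<Sum>x\<in>F. a x * f x z) y = (\<Sum>x\<in>F. a x * laplacian c (f x) y)"
proof (induction F rule: finite_induct)
  case empty
  then show ?case by (simp add: laplacian_def)
qed (simp add: laplacian_add laplacian_scale)

lemma laplacian_shift: "laplacian c (\<lambda>z. u z + k) y = laplacian c u y"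
  by (simp add: laplacian_def)

text \<open>
  The summands of the energy vanish unless the edge meets \<open>y\<close>. The edges out of \<open>y\<close> (below, \<open>h\<close>)
  and into \<open>y\<close> (below, \<open>k\<close>) contribute the Laplacian at \<open>y\<close> each; the loop at \<open>y\<close> contributes \<open>0\<close>.
\<close>

lemma energy_point_mass:
  shows "energy c u (point_mass y) = laplacian c u y" and "point_mass y \<in> dom_energy c"
proof -
  let ?N = "{z. 0 < c y z}"
  define h where "h = (\<lambda>(x, z). if x = y then c y z * (u y - u z) else 0)"
  define k where "k = (\<lambda>(x, z). if z = y then c y x * (u y - u x) else 0)"
  have c0: "c x z = 0" if "\<not> 0 < c x z" for x z using c_nonneg[of x z] that by simp
  have h: "h p = 0" if "p \<notin> Pair y ` ?N" for p using that c0 by (cases p) (auto simp: h_def)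
  have k: "k p = 0" if "p \<notin> (\<lambda>x. (x, y)) ` ?N" for p using that c0 by (cases p) (auto simp: k_def)
  have hs: "h summable_on UNIV" "infsum h UNIV = laplacian c u y"
  proof -
    show "h summable_on UNIV"
      by (rule summable_on_finite_support[of "Pair y ` ?N"]) (intro finite_imageI finite_nbrs, rule h)
    have "infsum h UNIV = sum h (Pair y ` ?N)" by (rule infsum_eq_sum) (intro finite_imageI finite_nbrs, rule h)
    also have "\<dots> = laplacian c u y"
      by (subst sum.reindex) (auto simp: inj_on_def h_def laplacian_def)
    finally show "infsum h UNIV = laplacian c u y" .
  qed
  have ks: "k summable_on UNIV" "infsum k UNIV = laplacian c u y"
  proof -
    show "k summable_on UNIV"
      by (rule summable_on_finite_support[of "(\<lambda>x. (x, y)) ` ?N"]) (intro finite_imageI finite_nbrs, rule k)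
    have "infsum k UNIV = sum k ((\<lambda>x. (x, y)) ` ?N)" by (rule infsum_eq_sum) (intro finite_imageI finite_nbrs, rule k)
    also have "\<dots> = laplacian c u y"
      by (subst sum.reindex) (auto simp: inj_on_def k_def laplacian_def)
    finally show "infsum k UNIV = laplacian c u y" .
  qed
  have "(case p of (x, z) \<Rightarrow> c x z * (u x - u z) * (point_mass y x - point_mass y z)) = h p + k p" for p
  proof (cases p)
    case (Pair x z)
    show ?thesis unfolding Pair using c_sym[of x y]
      by (cases "x = y"; cases "z = y") (simp_all add: h_def k_def point_mass_def right_diff_distrib)
  qed
  then have "(\<lambda>(x, z). c x z * (u x - u z) * (point_mass y x - point_mass y z)) = (\<lambda>p. h p + k p)" ..
  then show "energy c u (point_mass y) = laplacian c u y"
    using infsum_add[OF hs(1) ks(1)] hs(2) ks(2) by (simp add: energy_def)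
  have "(case p of (x, z) \<Rightarrow> c x z * (point_mass y x - point_mass y z)\<^sup>2) = 0"
    if p: "p \<notin> Pair y ` ?N \<union> (\<lambda>x. (x, y)) ` ?N" for p
  proof (cases p)
    case (Pair x z)
    show ?thesis unfolding Pair using p c0[of x z] c_sym[of x y]
      by (cases "x = y"; cases "z = y") (auto simp: Pair point_mass_def)
  qed
  then show "point_mass y \<in> dom_energy c"
    unfolding dom_energy_def mem_Collect_eq
    by (rule summable_on_finite_support[of "Pair y ` ?N \<union> (\<lambda>x. (x, y)) ` ?N", rotated])
      (assumption, intro finite_UnI finite_imageI finite_nbrs)
qed

lemma point_mass_expansion:
  assumes "finite F" "{x. f x \<noteq> 0} \<subseteq> F"
  shows "f = (\<lambda>z. \<Sum>x\<in>F. f x * point_mass x z)"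
proof
  fix z
  have "(\<Sum>x\<in>F. f x * point_mass x z) = (\<Sum>x\<in>F. if x = z then f x else 0)"
    by (intro sum.cong) (auto simp: point_mass_def)
  also have "\<dots> = f z" using assms by auto
  finally show "f z = (\<Sum>x\<in>F. f x * point_mass x z)" ..
qed

lemma finite_support_dom_energy:
  assumes "finite {x. f x \<noteq> 0}"
  shows "f \<in> dom_energy c"
  by (subst point_mass_expansion[OF assms order_refl]) (rule dom_energy_sum[OF assms energy_point_mass(2)])

text \<open>Green's identity, which has no boundary term at infinity because \<open>f\<close> has finite support.\<close>

lemma energy_finite_support:
  assumes u: "u \<in> dom_energy c" and f: "finite {x. f x \<noteq> 0}"
  shows "energy c f u = (\<Sum>x | f x \<noteq> 0. f x * laplacian c u x)"
proof -
  have "energy c f u = energy c (\<lambda>z. \<Sum>x | f x \<noteq> 0. f x * point_mass x z) u"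
    by (rule arg_cong[where f = "\<lambda>g. energy c g u", OF point_mass_expansion[OF f order_refl]])
  also have "\<dots> = (\<Sum>x | f x \<noteq> 0. f x * energy c (point_mass x) u)"
    by (intro energy_sum u f energy_point_mass(2))
  finally show ?thesis by (simp add: energy_commute[of _ u] energy_point_mass(1))
qed

lemma laplacian_support:
  assumes f: "finite {x. f x \<noteq> 0}"
  defines "S \<equiv> {x. f x \<noteq> 0} \<union> (\<Union>x\<in>{x. f x \<noteq> 0}. {y. 0 < c x y})"
  shows "finite S" and "{x. laplacian c f x \<noteq> 0} \<subseteq> S"
proof -
  show "finite S" using f by (simp add: S_def)
  show "{x. laplacian c f x \<noteq> 0} \<subseteq> S"
  proof (rule ccontr)
    assume "\<not> {x. laplacian c f x \<noteq> 0} \<subseteq> S"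
    then obtain x where x: "laplacian c f x \<noteq> 0" "x \<notin> S" by blast
    have "\<exists>y. 0 < c x y \<and> f x - f y \<noteq> 0"
    proof (rule ccontr)
      assume "\<not> ?thesis"
      then have "laplacian c f x = 0" unfolding laplacian_def by (intro sum.neutral) auto
      then show False using x(1) by simp
    qed
    then obtain y where "0 < c x y" "f x - f y \<noteq> 0" by blast
    then show False using x(2) c_sym[of x y] by (auto simp: S_def)
  qed
qed

lemma finite_support_laplacian: "finite {x. f x \<noteq> 0} \<Longrightarrow> finite {x. laplacian c f x \<noteq> 0}"
  by (rule finite_subset[OF laplacian_support(2) laplacian_support(1)])

text \<open>
  Symmetry of the Laplacian when only one function has finite support and the other is
  arbitrary: cutting \<open>g\<close> off outside the support of \<open>f\<close> and its neighbours changes neither side,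
  and for two finitely supported functions both sides are their energy product.
\<close>

lemma sum_laplacian_swap:
  assumes f: "finite {x. f x \<noteq> 0}"
  shows "(\<Sum>x | laplacian c f x \<noteq> 0. laplacian c f x * g x) = (\<Sum>x | f x \<noteq> 0. f x * laplacian c g x)"
proof -
  define S where "S = {x. f x \<noteq> 0} \<union> (\<Union>x\<in>{x. f x \<noteq> 0}. {y. 0 < c x y})"
  note S = laplacian_support[OF f, folded S_def]
  define h where "h x = (if x \<in> S then g x else 0)" for x
  have h: "finite {x. h x \<noteq> 0}" using S(1) by (rule finite_subset[rotated]) (auto simp: h_def)
  have "(\<Sum>x | laplacian c f x \<noteq> 0. laplacian c f x * g x) = (\<Sum>x\<in>S. laplacian c f x * g x)"
    using S by (intro sum.mono_neutral_left) auto
  also have "\<dots> = (\<Sum>x | h x \<noteq> 0. h x * laplacian c f x)"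
    using S by (intro sum.mono_neutral_cong_right) (auto simp: h_def)
  also have "\<dots> = energy c h f"
    using h f by (simp add: energy_finite_support finite_support_dom_energy)
  also have "\<dots> = energy c f h" by (rule energy_commute)
  also have "\<dots> = (\<Sum>x | f x \<noteq> 0. f x * laplacian c h x)"
    using h f by (simp add: energy_finite_support finite_support_dom_energy)
  also have "\<dots> = (\<Sum>x | f x \<noteq> 0. f x * laplacian c g x)"
  proof (rule sum.cong)
    fix x assume x: "x \<in> {x. f x \<noteq> 0}"
    have "laplacian c h x = laplacian c g x"
      unfolding laplacian_def using x by (intro sum.cong) (auto simp: h_def S_def)
    then show "f x * laplacian c h x = f x * laplacian c g x" by simp
  qed simp
  finally show ?thesis .
qed

subsection \<open>Dipoles and monopoles\<close>

text \<open>
  The range of the gradient is closed even under pointwise limits: convergence of differences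
  along edges propagates along paths, and every two vertices are joined by a path.
\<close>

lemma limit_of_gradients:
  assumes lim: "\<And>p. (\<lambda>n. grad (u n) p) \<longlonglongrightarrow> l p"
  shows "\<exists>v. grad v = l \<and> (\<forall>x y. (\<lambda>n. u n x - u n y) \<longlonglongrightarrow> v x - v y)"
proof -
  have edge: "(\<lambda>n. u n x - u n y) \<longlonglongrightarrow> l (x, y) / sqrt (c x y)" if "0 < c x y" for x y
  proof -
    have "(\<lambda>n. grad (u n) (x, y) / sqrt (c x y)) \<longlonglongrightarrow> l (x, y) / sqrt (c x y)"
      using that by (intro tendsto_divide lim tendsto_const) simp
    then show ?thesis using that by (simp add: grad_def)
  qed
  have "\<exists>r. (\<lambda>n. u n x - u n y) \<longlonglongrightarrow> r" for x y
    using connected[of x y]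
  proof (induction rule: rtrancl_induct)
    case base
    show ?case by (intro exI[of _ 0]) simp
  next
    case (step y z)
    then obtain r where "(\<lambda>n. u n x - u n y) \<longlonglongrightarrow> r" by blast
    then have "(\<lambda>n. (u n x - u n y) + (u n y - u n z)) \<longlonglongrightarrow> r + l (y, z) / sqrt (c y z)"
      using step(2) by (intro tendsto_add edge) auto
    then show ?case by (intro exI) simp
  qed
  then obtain r where r: "\<And>x y. (\<lambda>n. u n x - u n y) \<longlonglongrightarrow> r x y" by metis
  obtain x0 :: 'v where True by blast
  define v where "v x = r x x0" for x
  have "(\<lambda>n. (u n x - u n x0) - (u n y - u n x0)) \<longlonglongrightarrow> v x - v y" for x y
    unfolding v_def by (intro tendsto_diff r)
  then have v: "(\<lambda>n. u n x - u n y) \<longlonglongrightarrow> v x - v y" for x y by simp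
  have "grad v p = l p" for p
  proof (cases p)
    case (Pair x y)
    have "(\<lambda>n. grad (u n) (x, y)) \<longlonglongrightarrow> grad v (x, y)"
      unfolding grad_def by (auto intro!: tendsto_intros v)
    then show ?thesis using lim LIMSEQ_unique Pair by blast
  qed
  then show ?thesis using v by (intro exI[of _ v]) auto
qed

text \<open>
  The closedness condition asks only for stability under pointwise limits of differences, which
  is immediate for conditions that involve finitely many differences, such as prescribed values
  of \<open>u x - u y\<close> or of the Laplacian.
\<close>

lemma energy_minimizer:
  assumes A: "A \<subseteq> dom_energy c" "A \<noteq> {}"
    and mid: "\<And>u v. u \<in> A \<Longrightarrow> v \<in> A \<Longrightarrow> (\<lambda>x. (u x + v x) / 2) \<in> A"
    and closed: "\<And>u v. (\<And>n. u n \<in> A) \<Longrightarrow> (\<And>x y. (\<lambda>n. u n x - u n y) \<longlonglongrightarrow> v x - v y) \<Longrightarrow>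
      v \<in> dom_energy c \<Longrightarrow> v \<in> A"
  shows "\<exists>v\<in>A. \<forall>u\<in>A. energy c v v \<le> energy c u u"
proof -
  have 1: "grad ` A \<subseteq> hcarrier ell2" using A by (auto simp: dom_energy_iff)
  have 2: "grad ` A \<noteq> {}" using A by simp
  have 3: "(\<lambda>x. (f x + g x) / 2) \<in> grad ` A" if "f \<in> grad ` A" "g \<in> grad ` A" for f g
  proof -
    obtain u v where uv: "u \<in> A" "v \<in> A" "f = grad u" "g = grad v" using \<open>f \<in> _\<close> \<open>g \<in> _\<close> by auto
    have "(\<lambda>x. (f x + g x) / 2) = grad (\<lambda>x. (u x + v x) / 2)"
      by (auto simp: uv grad_def fun_eq_iff field_simps)
    then show ?thesis using mid[OF uv(1,2)] by blast
  qed
  obtain d f l where d: "\<forall>g\<in>grad ` A. d \<le> hinner ell2 g g" "\<forall>n::nat. f n \<in> grad ` A"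
    "\<forall>p. (\<lambda>n. f n p) \<longlonglongrightarrow> l p" "l \<in> hcarrier ell2" "hinner ell2 l l \<le> d"
    using ell2_minimizing_sequence[OF 1 2 3] by blast
  have "\<exists>u. u \<in> A \<and> f n = grad u" for n using d(2) by blast
  then obtain u where u: "\<And>n. u n \<in> A" "\<And>n. f n = grad (u n)" by metis
  have "\<And>p. (\<lambda>n. grad (u n) p) \<longlonglongrightarrow> l p" using d(3) unfolding u(2) by blast
  from limit_of_gradients[OF this]
  obtain v where v: "grad v = l" "\<forall>x y. (\<lambda>n. u n x - u n y) \<longlonglongrightarrow> v x - v y"
    by blast
  have "v \<in> dom_energy c" using v(1) d(4) by (simp add: dom_energy_iff)
  then have "v \<in> A" using closed[of u v] u(1) v(2) by simp
  moreover have "energy c v v \<le> energy c w w" if "w \<in> A" for w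
    using d(1) d(5) v(1) that by (fastforce simp: energy_grad intro: order_trans)
  ultimately show ?thesis by blast
qed

text \<open>
  Riesz representation of \<open>u \<mapsto> u x - u x0\<close> without first proving this functional bounded: the
  minimizer \<open>v\<close> of the energy on the affine hyperplane where the functional is \<open>1\<close> is orthogonal
  to its kernel, so \<open>v / \<parallel>v\<parallel>\<^sup>2\<close> represents it.
\<close>

lemma dipole_exists:
  "\<exists>v\<in>dom_energy c. \<forall>u\<in>dom_energy c. energy c v u = u x - u x0"
proof (cases "x = x0")
  case True
  have "(\<lambda>_. 0) \<in> dom_energy c" by (simp add: dom_energy_def split_def)
  moreover have "energy c (\<lambda>_. 0) u = u x - u x0" for u using True by (simp add: energy_def split_def)
  ultimately show ?thesis by blast
next
  case False
  define A where "A = {u \<in> dom_energy c. u x - u x0 = 1}"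
  have "\<exists>v\<in>A. \<forall>u\<in>A. energy c v v \<le> energy c u u"
  proof (rule energy_minimizer[of A])
    show "A \<subseteq> dom_energy c" by (auto simp: A_def)
    have "point_mass x \<in> A" using False by (simp add: A_def energy_point_mass(2)) (simp add: point_mass_def)
    then show "A \<noteq> {}" by blast
    show "(\<lambda>z. (u z + w z) / 2) \<in> A" if "u \<in> A" "w \<in> A" for u w
      using that dom_energy_scale[OF dom_energy_add, of u w "1/2"] by (auto simp: A_def field_simps)
    show "w \<in> A" if u: "\<And>n. u n \<in> A" and lim: "\<And>x y. (\<lambda>n. u n x - u n y) \<longlonglongrightarrow> w x - w y"
      and w: "w \<in> dom_energy c" for u w
    proof -
      have "(\<lambda>n. u n x - u n x0) \<longlonglongrightarrow> w x - w x0" by (rule lim)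
      moreover have "(\<lambda>n. u n x - u n x0) = (\<lambda>n. 1)" using u by (simp add: A_def)
      ultimately show ?thesis using w by (simp add: A_def LIMSEQ_const_iff)
    qed
  qed
  then obtain v where v: "v \<in> A" "\<And>u. u \<in> A \<Longrightarrow> energy c v v \<le> energy c u u" by blast
  have vd: "v \<in> dom_energy c" and v1: "v x - v x0 = 1" using v(1) by (auto simp: A_def)
  have orth: "energy c w v = 0" if w: "w \<in> dom_energy c" and w0: "w x = w x0" for w
  proof (rule linear_term_vanishes)
    fix s :: real
    have sw: "(\<lambda>z. s * w z) \<in> dom_energy c" using w by (rule dom_energy_scale)
    have d: "(\<lambda>z. v z + s * w z) \<in> dom_energy c" using vd sw by (rule dom_energy_add)
    then have "(\<lambda>z. v z + s * w z) \<in> A" using v1 w0 by (simp add: A_def)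
    then have "energy c v v \<le> energy c (\<lambda>z. v z + s * w z) (\<lambda>z. v z + s * w z)" by (rule v(2))
    also have "\<dots> = energy c v v + 2 * s * energy c w v + s\<^sup>2 * energy c w w"
      using energy_square_add[OF vd sw] energy_square_scale[OF w, of s] energy_scale[OF w vd, of s]
        energy_commute[of v "\<lambda>z. s * w z"] by simp
    finally show "0 \<le> 2 * s * energy c w v + s\<^sup>2 * energy c w w" by simp
  qed
  have "energy c v v \<noteq> 0" using constant_if_energy_zero[OF vd, of x x0] v1 by auto
  define D where "D z = 1 / energy c v v * v z" for z
  have "energy c D u = u x - u x0" if u: "u \<in> dom_energy c" for u
  proof -
    define t where "t = u x - u x0"
    have tv: "(\<lambda>z. t * v z) \<in> dom_energy c" using vd by (rule dom_energy_scale)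
    have "t * v x - t * v x0 = t" using v1 by (metis mult.right_neutral right_diff_distrib)
    then have "u x - t * v x = u x0 - t * v x0" by (simp add: t_def)
    then have "energy c (\<lambda>z. u z - t * v z) v = 0"
      using u tv by (intro orth dom_energy_diff)
    then have "energy c u v = t * energy c v v"
      using u tv vd by (simp add: energy_diff energy_scale)
    then show ?thesis
      using \<open>energy c v v \<noteq> 0\<close> energy_scale[OF vd u, of "1 / energy c v v"] energy_commute[of u v]
      unfolding D_def t_def by simp
  qed
  moreover have "D \<in> dom_energy c" unfolding D_def using vd by (rule dom_energy_scale)
  ultimately show ?thesis by blast
qed

lemma dipole:
  shows dipole_carrier: "dipole c x0 x \<in> hcarrier E"
    and energy_dipole: "\<And>u. u \<in> dom_energy c \<Longrightarrow> energy c (rep (dipole c x0 x)) u = u x - u x0"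
proof -
  obtain v where v: "v \<in> dom_energy c" "\<And>u. u \<in> dom_energy c \<Longrightarrow> energy c v u = u x - u x0"
    using dipole_exists[of x x0] by blast
  define P where "P = (\<lambda>V. V \<in> hcarrier E \<and> (\<forall>U\<in>hcarrier E. hinner E V U = rep U x - rep U x0))"
  have rep_eq: "energy c (rep V) u = u x - u x0" if V: "P V" and u: "u \<in> dom_energy c" for V u
  proof -
    have "hinner E V (const_class u) = rep (const_class u) x - rep (const_class u) x0"
      using V class_carrier[OF u] by (auto simp: P_def)
    moreover have "hinner E V (const_class u) = energy c (rep V) u"
      using V hinner_energy_space[of c "rep V" u] class_rep[of V] by (simp add: P_def)
    ultimately show ?thesis using rep_const_class[of u] by auto
  qed
  have "P (const_class v)"
    unfolding P_def
  proof (intro conjI ballI)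
    fix U assume U: "U \<in> hcarrier E"
    have "hinner E (const_class v) U = energy c v (rep U)"
      using hinner_energy_space[of c v "rep U"] class_rep[OF U] by simp
    then show "hinner E (const_class v) U = rep U x - rep U x0" using v(2) rep_dom_energy[OF U] by simp
  qed (rule class_carrier[OF v(1)])
  moreover have "V = const_class v" if V: "P V" for V
  proof -
    have d: "rep V \<in> dom_energy c" using V rep_dom_energy by (simp add: P_def)
    note dv = dom_energy_diff[OF d v(1)]
    have "energy c (\<lambda>z. rep V z - v z) (\<lambda>z. rep V z - v z) = 0"
      using energy_diff[OF d v(1) dv] rep_eq[OF V dv] v(2)[OF dv] by simp
    then have "const_class (rep V) = const_class v" by (intro class_eq_if_energy_zero d v(1)) simp
    then show ?thesis using class_rep[of V] V by (simp add: P_def)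
  qed
  ultimately have "P (THE V. P V)" by (rule theI)
  then have P: "P (dipole c x0 x)" by (simp add: dipole_def P_def)
  show "dipole c x0 x \<in> hcarrier E" using P by (simp add: P_def)
  show "energy c (rep (dipole c x0 x)) u = u x - u x0" if "u \<in> dom_energy c" for u
    using rep_eq[OF P that] .
qed

lemma laplacian_dipole: "laplacian c (rep (dipole c x0 x)) y = point_mass x y - point_mass x0 y"
  using energy_dipole[OF energy_point_mass(2), of x0 x y]
  by (simp add: energy_point_mass(1)) (simp add: point_mass_def eq_commute)

lemma monopole_class: "u \<in> dom_energy c \<Longrightarrow> laplacian c u = point_mass x \<Longrightarrow> monopole c x (const_class u)"
  by (simp add: monopole_def class_carrier laplacian_rep)

text \<open>
  Monopoles at \<open>x0\<close> form a non-empty set: subtracting a dipole moves a given monopole from \<open>x\<close> to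
  \<open>x0\<close>. The minimizer is unique by the parallelogram law, which is what the definite description
  in the definition requires.
\<close>

lemma min_monopole:
  assumes "transient c"
  shows "monopole c x0 (min_monopole c x0)"
proof -
  obtain x w where w: "monopole c x w" using assms by (auto simp: transient_def)
  define A where "A = {u \<in> dom_energy c. laplacian c u = point_mass x0}"
  have mid: "(\<lambda>z. (u z + w z) / 2) \<in> A" if "u \<in> A" "w \<in> A" for u w
  proof -
    have "(\<lambda>z. (u z + w z) / 2) = (\<lambda>z. 1/2 * (u z + w z))" by simp
    then show ?thesis
      using that dom_energy_scale[OF dom_energy_add, of u w "1/2"]
      by (simp only: A_def mem_Collect_eq fun_eq_iff laplacian_scale laplacian_add) simp
  qed
  have "\<exists>v\<in>A. \<forall>u\<in>A. energy c v v \<le> energy c u u"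
  proof (rule energy_minimizer[of A])
    show "A \<subseteq> dom_energy c" by (auto simp: A_def)
    have "(\<lambda>z. rep w z - rep (dipole c x0 x) z) \<in> A"
      using w dipole_carrier[of x0 x] laplacian_add[of "rep w" "\<lambda>z. -1 * rep (dipole c x0 x) z"]
        laplacian_scale[of "-1" "rep (dipole c x0 x)"]
      by (auto simp: A_def monopole_def laplacian_dipole fun_eq_iff intro!: dom_energy_diff rep_dom_energy)
    then show "A \<noteq> {}" by blast
    show "w \<in> A" if u: "\<And>n. u n \<in> A" and lim: "\<And>x y. (\<lambda>n. u n x - u n y) \<longlonglongrightarrow> w x - w y"
      and w: "w \<in> dom_energy c" for u w
    proof -
      have "laplacian c w y = point_mass x0 y" for y
      proof -
        have "(\<lambda>n. laplacian c (u n) y) \<longlonglongrightarrow> laplacian c w y"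
          unfolding laplacian_def by (intro tendsto_intros lim)
        moreover have "(\<lambda>n. laplacian c (u n) y) = (\<lambda>n. point_mass x0 y)" using u by (simp add: A_def)
        ultimately show ?thesis by (simp add: LIMSEQ_const_iff)
      qed
      then show ?thesis using w by (auto simp: A_def)
    qed
  qed (rule mid)
  then obtain v where v: "v \<in> A" "\<And>u. u \<in> A \<Longrightarrow> energy c v v \<le> energy c u u" by blast
  have vd: "v \<in> dom_energy c" using v(1) by (simp add: A_def)
  define P where "P = (\<lambda>W. monopole c x0 W \<and> (\<forall>W'. monopole c x0 W' \<longrightarrow> hnorm E W \<le> hnorm E W'))"
  have inA: "rep W \<in> A" if "monopole c x0 W" for W
    using that rep_dom_energy by (simp add: A_def monopole_def)
  have "P (const_class v)"
    unfolding P_def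
  proof (intro conjI allI impI)
    show "monopole c x0 (const_class v)" using v(1) monopole_class by (simp add: A_def)
    fix W assume "monopole c x0 W"
    then show "hnorm E (const_class v) \<le> hnorm E W"
      using v(2)[OF inA, of W] by (simp add: hnorm_def hinner_energy_space E_inner)
  qed
  moreover have "W = const_class v" if W: "P W" for W
  proof -
    have m: "monopole c x0 W" and le: "hnorm E W \<le> hnorm E (const_class v)"
      using W v(1) monopole_class by (auto simp: P_def A_def)
    define u where "u = rep W"
    have u: "u \<in> A" "u \<in> dom_energy c" "W = const_class u"
      using inA[OF m] m class_rep by (auto simp: u_def A_def monopole_def)
    have le': "energy c u u \<le> energy c v v"
      using le by (simp add: hnorm_def hinner_energy_space u(3))
    have "(\<lambda>z. 1/2 * (u z + v z)) \<in> A" using mid[OF u(1) v(1)] by simp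
    then have "energy c v v \<le> energy c (\<lambda>z. 1/2 * (u z + v z)) (\<lambda>z. 1/2 * (u z + v z))" by (rule v(2))
    also have "\<dots> = 1/4 * (energy c u u + 2 * energy c u v + energy c v v)"
      using energy_square_scale[OF dom_energy_add[OF u(2) vd], of "1/2"] energy_square_add[OF u(2) vd]
      by (simp add: power2_eq_square)
    finally have 1: "4 * energy c v v \<le> energy c u u + 2 * energy c u v + energy c v v" by simp
    have "energy c (\<lambda>z. u z - v z) (\<lambda>z. u z - v z) = energy c u u - 2 * energy c u v + energy c v v"
      by (rule energy_square_diff[OF u(2) vd])
    then have "energy c (\<lambda>z. u z - v z) (\<lambda>z. u z - v z) \<le> 0" using 1 le' by simp
    then show ?thesis using class_eq_if_energy_zero[OF u(2) vd] u(3) by simp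
  qed
  ultimately have "P (THE W. P W)" by (rule theI)
  then show ?thesis by (simp add: min_monopole_def P_def)
qed

end

section \<open>Finitely supported functions\<close>

lemma finite_support_ell2: "finite {x. f x \<noteq> 0} \<Longrightarrow> f \<in> hcarrier ell2"
  unfolding ell2_carrier by (rule summable_on_finite_support[of "{x. f x \<noteq> 0}"]) auto

lemma finite_support_add: "finite {x. f x \<noteq> (0::real)} \<Longrightarrow> finite {x. g x \<noteq> 0} \<Longrightarrow> finite {x. f x + g x \<noteq> 0}"
  by (rule finite_subset[of _ "{x. f x \<noteq> 0} \<union> {x. g x \<noteq> 0}"]) auto

lemma finite_support_scale: "finite {x. f x \<noteq> (0::real)} \<Longrightarrow> finite {x. a * f x \<noteq> 0}"
  by (rule finite_subset[of _ "{x. f x \<noteq> 0}"]) auto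

lemma finite_support_point_mass: "finite {y. point_mass x y \<noteq> 0}"
  by (simp add: point_mass_def)

text \<open>
  The function \<open>s\<close> is the passage from functions to vectors: the identity for square summable
  functions, and \<^const>\<open>const_class\<close> for the energy space.
\<close>

lemma sum_in_subspace:
  assumes V: "hsubspace H V" and S: "S \<subseteq> V" and "finite F"
    and zero: "hzero H = s (\<lambda>_. 0)"
    and add: "\<And>f g. hadd H (s f) (s g) = s (\<lambda>z. f z + g z)"
    and scale: "\<And>a f. hscale H a (s f) = s (\<lambda>z. a * f z)"
    and f: "\<And>x. x \<in> F \<Longrightarrow> s (f x) \<in> S"
  shows "s (\<lambda>z. \<Sum>x\<in>F. a x * f x z :: real) \<in> V"
  using \<open>finite F\<close> f
proof (induction F rule: finite_induct)
  case empty
  have "hzero H \<in> V" using V by (simp add: hsubspace_def)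
  then show ?case using zero by simp
next
  case (insert x F)
  have "s (f x) \<in> V" using insert S by auto
  then have "hadd H (hscale H (a x) (s (f x))) (s (\<lambda>z. \<Sum>x\<in>F. a x * f x z)) \<in> V"
    using V insert by (simp add: hsubspace_def)
  then show ?case using insert by (simp add: add scale)
qed

lemma dom_Phi_iff: "\<xi> \<in> dom_Phi \<longleftrightarrow> finite {x. \<xi> x \<noteq> 0}"
proof
  let ?V = "{f :: 'a \<Rightarrow> real. finite {x. f x \<noteq> 0}}"
  have "hsubspace ell2 ?V"
    using finite_support_ell2 finite_support_add finite_support_scale by (auto simp: hsubspace_def ell2_def)
  moreover have "range point_mass \<subseteq> ?V" using finite_support_point_mass by auto
  moreover assume "\<xi> \<in> dom_Phi"
  ultimately show "finite {x. \<xi> x \<noteq> 0}" by (auto simp: dom_Phi_def hspan_def)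
next
  assume fin: "finite {x. \<xi> x \<noteq> 0}"
  have "(\<lambda>z. \<Sum>x | \<xi> x \<noteq> 0. \<xi> x * point_mass x z) \<in> V"
    if V: "hsubspace ell2 V" "range point_mass \<subseteq> V" for V
    using sum_in_subspace[where s = "\<lambda>f. f", OF V fin, of point_mass \<xi>] by (simp add: ell2_def)
  moreover have "\<xi> z = (\<Sum>x | \<xi> x \<noteq> 0. \<xi> x * point_mass x z)" for z
  proof -
    have "(\<Sum>x | \<xi> x \<noteq> 0. \<xi> x * point_mass x z) = (\<Sum>x | \<xi> x \<noteq> 0. if x = z then \<xi> x else 0)"
      by (intro sum.cong) (auto simp: point_mass_def)
    then show ?thesis using fin by auto
  qed
  then have "\<xi> = (\<lambda>z. \<Sum>x | \<xi> x \<noteq> 0. \<xi> x * point_mass x z)" ..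
  ultimately show "\<xi> \<in> dom_Phi" by (auto simp: dom_Phi_def hspan_def)
qed

lemma (in inner_space) op_closure_contains:
  assumes "(u, w) \<in> T" "u \<in> hcarrier H" "w \<in> hcarrier H"
  shows "(u, w) \<in> op_closure H T"
proof -
  have "hnorm H (hdiff H v v) = 0" if "v \<in> hcarrier H" for v
    using that by (simp add: hnorm_def hdiff_def)
  then have "hnorm H (hdiff H u u) = 0" "hnorm H (hdiff H w w) = 0" using assms by auto
  then show ?thesis
    using assms unfolding op_closure_def by (auto intro!: bexI[of _ "(u, w)"])
qed

context conductance
begin

section \<open>Density of the range of the Laplacian plus the identity\<close>

text \<open>
  Maximum principle. A square summable \<open>l\<close> takes values at least \<open>l x > 0\<close> at finitely many
  vertices only, hence has a maximum, where its Laplacian is non-negative although \<open>- l\<close> is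
  negative there.
\<close>

lemma laplacian_eigenvector_minus_one_nonpos:
  assumes l: "l \<in> hcarrier ell2" and eig: "\<And>x. laplacian c l x = - l x"
  shows "l x \<le> 0"
proof (rule ccontr)
  assume "\<not> l x \<le> 0"
  then have pos: "0 < l x" by simp
  have "card F \<le> hinner ell2 l l / (l x)\<^sup>2" if F: "F \<subseteq> {y. l x \<le> l y}" "finite F" for F
  proof -
    have "card F * (l x)\<^sup>2 = (\<Sum>y\<in>F. (l x)\<^sup>2)" by simp
    also have "\<dots> \<le> (\<Sum>y\<in>F. (l y)\<^sup>2)"
      using F pos by (intro sum_mono power_mono) auto
    also have "\<dots> \<le> hinner ell2 l l" using ell2_sum_le l F by blast
    finally show ?thesis using pos by (simp add: le_divide_eq)
  qed
  then have "card F \<le> nat \<lfloor>hinner ell2 l l / (l x)\<^sup>2\<rfloor>" if "F \<subseteq> {y. l x \<le> l y}" "finite F" for F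
    using that by (simp add: le_nat_floor)
  then have fin: "finite {y. l x \<le> l y}" by (metis finite_if_finite_subsets_card_bdd)
  then have fi: "finite (l ` {y. l x \<le> l y})" by simp
  have "l ` {y. l x \<le> l y} \<noteq> {}" by auto
  then obtain m where m: "l m = Max (l ` {y. l x \<le> l y})" "l x \<le> l m"
    using Max_in[OF fi] by auto
  have max: "l y \<le> l m" for y
    using Max_ge[OF fi, of "l y"] m by (cases "l x \<le> l y") auto
  have "0 \<le> laplacian c l m"
    unfolding laplacian_def by (intro sum_nonneg mult_nonneg_nonneg c_nonneg) (simp add: max)
  then show False using eig[of m] m(2) pos by simp
qed

text \<open>
  The limit \<open>l\<close> of a sequence in \<open>\<xi> - range (\<Delta> + 1)\<close> that minimizes the norm is orthogonal to the
  range. Testing with point masses, this says \<open>\<Delta>l = -l\<close>, so \<open>l = 0\<close> by the maximum principle applied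
  to \<open>l\<close> and \<open>-l\<close>, and the distance from \<open>\<xi>\<close> to the range is \<open>0\<close>.
\<close>

lemma dense_range:
  assumes \<xi>: "finite {x. \<xi> x \<noteq> 0}" and e: "0 < e"
  shows "\<exists>\<eta>. finite {x. \<eta> x \<noteq> 0} \<and>
    hinner ell2 (\<lambda>x. \<xi> x - (laplacian c \<eta> x + \<eta> x)) (\<lambda>x. \<xi> x - (laplacian c \<eta> x + \<eta> x)) < e"
proof -
  define T where "T \<eta> x = laplacian c \<eta> x + \<eta> x" for \<eta> x
  define K where "K = {f. \<exists>\<eta>. finite {x. \<eta> x \<noteq> 0} \<and> f = (\<lambda>x. \<xi> x - T \<eta> x)}"
  have Tfin: "finite {x. T \<eta> x \<noteq> 0}" if "finite {x. \<eta> x \<noteq> 0}" for \<eta>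
    unfolding T_def by (intro finite_support_add finite_support_laplacian that)
  have Kfin: "finite {x. f x \<noteq> 0}" if "f \<in> K" for f
  proof -
    obtain \<eta> where \<eta>: "finite {x. \<eta> x \<noteq> 0}" "f = (\<lambda>x. \<xi> x - T \<eta> x)" using \<open>f \<in> K\<close> by (auto simp: K_def)
    show ?thesis using finite_support_add[OF \<xi> finite_support_scale[OF Tfin[OF \<eta>(1)], of "-1"]] \<eta>(2) by simp
  qed
  have T_comb: "T (\<lambda>x. a * \<eta> x + b * \<zeta> x) x = a * T \<eta> x + b * T \<zeta> x" for a b \<eta> \<zeta> x
    by (simp add: T_def laplacian_add laplacian_scale algebra_simps)
  have KI: "(\<lambda>x. \<xi> x - T \<eta> x) \<in> K" if "finite {x. \<eta> x \<noteq> 0}" for \<eta>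
    using that by (auto simp: K_def)
  have K1: "K \<subseteq> hcarrier ell2" using Kfin finite_support_ell2 by blast
  have K2: "K \<noteq> {}" using KI[OF \<xi>] by blast
  have K3: "(\<lambda>x. (f x + g x) / 2) \<in> K" if fg: "f \<in> K" "g \<in> K" for f g
  proof -
    obtain \<eta> where \<eta>: "finite {x. \<eta> x \<noteq> 0}" "f = (\<lambda>x. \<xi> x - T \<eta> x)" using fg by (auto simp: K_def)
    obtain \<zeta> where \<zeta>: "finite {x. \<zeta> x \<noteq> 0}" "g = (\<lambda>x. \<xi> x - T \<zeta> x)" using fg by (auto simp: K_def)
    have fin: "finite {x. 1/2 * \<eta> x + 1/2 * \<zeta> x \<noteq> 0}"
      by (intro finite_support_add finite_support_scale \<eta> \<zeta>)
    have eq: "(\<lambda>x. (f x + g x) / 2) = (\<lambda>x. \<xi> x - T (\<lambda>x. 1/2 * \<eta> x + 1/2 * \<zeta> x) x)"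
      unfolding T_comb by (auto simp: \<eta> \<zeta> fun_eq_iff field_simps)
    show ?thesis unfolding eq by (rule KI[OF fin])
  qed
  obtain d f l where d: "\<forall>g\<in>K. d \<le> hinner ell2 g g" "\<forall>n::nat. f n \<in> K"
    "(\<lambda>n. hinner ell2 (f n) (f n)) \<longlonglongrightarrow> d" "\<forall>x. (\<lambda>n. f n x) \<longlonglongrightarrow> l x" "l \<in> hcarrier ell2"
    "(\<lambda>n. hinner ell2 (\<lambda>x. f n x - l x) (\<lambda>x. f n x - l x)) \<longlonglongrightarrow> 0"
    using ell2_minimizing_sequence[OF K1 K2 K3] by blast
  have orth: "hinner ell2 (T \<eta>) l = 0" if \<eta>: "finite {x. \<eta> x \<noteq> 0}" for \<eta>
  proof (rule linear_term_vanishes)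
    fix s :: real
    have Tc: "T \<eta> \<in> hcarrier ell2" using Tfin[OF \<eta>] by (rule finite_support_ell2)
    have inner_T: "hinner ell2 (T \<eta>) g = (\<Sum>x | T \<eta> x \<noteq> 0. T \<eta> x * g x)" for g
      unfolding ell2_inner by (rule infsum_eq_sum) (use Tfin[OF \<eta>] in auto)
    have lim: "(\<lambda>n. hinner ell2 (T \<eta>) (f n)) \<longlonglongrightarrow> hinner ell2 (T \<eta>) l"
      unfolding inner_T using d(4) by (intro tendsto_intros) auto
    have "d \<le> hinner ell2 (f n) (f n) + 2 * s * hinner ell2 (T \<eta>) (f n) + s\<^sup>2 * hinner ell2 (T \<eta>) (T \<eta>)" for n
    proof -
      obtain \<zeta> where \<zeta>: "finite {x. \<zeta> x \<noteq> 0}" "f n = (\<lambda>x. \<xi> x - T \<zeta> x)" using d(2) by (auto simp: K_def)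
      have fin: "finite {x. 1 * \<zeta> x + (- s) * \<eta> x \<noteq> 0}"
        by (intro finite_support_add finite_support_scale \<eta> \<zeta>)
      have eq: "hadd ell2 (f n) (hscale ell2 s (T \<eta>)) = (\<lambda>x. \<xi> x - T (\<lambda>x. 1 * \<zeta> x + (- s) * \<eta> x) x)"
        unfolding T_comb by (auto simp: \<zeta> fun_eq_iff)
      have "hadd ell2 (f n) (hscale ell2 s (T \<eta>)) \<in> K" unfolding eq by (rule KI[OF fin])
      then have "d \<le> hinner ell2 (hadd ell2 (f n) (hscale ell2 s (T \<eta>))) (hadd ell2 (f n) (hscale ell2 s (T \<eta>)))"
        using d(1) by blast
      moreover have "f n \<in> hcarrier ell2" using d(2) K1 by blast
      ultimately show ?thesis
        using Tc ell2.inner_commute[of "f n" "T \<eta>"]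
        by (simp del: ell2_ops add: power2_eq_square algebra_simps)
    qed
    moreover have "(\<lambda>n. hinner ell2 (f n) (f n) + 2 * s * hinner ell2 (T \<eta>) (f n) + s\<^sup>2 * hinner ell2 (T \<eta>) (T \<eta>))
        \<longlonglongrightarrow> d + 2 * s * hinner ell2 (T \<eta>) l + s\<^sup>2 * hinner ell2 (T \<eta>) (T \<eta>)"
      by (intro tendsto_intros d(3) lim)
    ultimately have "d \<le> d + 2 * s * hinner ell2 (T \<eta>) l + s\<^sup>2 * hinner ell2 (T \<eta>) (T \<eta>)"
      by (intro LIMSEQ_le_const) auto
    then show "0 \<le> 2 * s * hinner ell2 (T \<eta>) l + s\<^sup>2 * hinner ell2 (T \<eta>) (T \<eta>)" by simp
  qed
  have eig: "laplacian c l x = - l x" for x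
  proof -
    let ?p = "point_mass x :: 'v \<Rightarrow> real"
    have p: "finite {y. ?p y \<noteq> 0}" by (rule finite_support_point_mass)
    have Lc: "laplacian c ?p \<in> hcarrier ell2" and pc: "?p \<in> hcarrier ell2"
      using p finite_support_laplacian finite_support_ell2 by auto
    have supp: "{y. ?p y \<noteq> 0} = {x}" by (auto simp: point_mass_def)
    have "hinner ell2 (laplacian c ?p) l = (\<Sum>y | laplacian c ?p y \<noteq> 0. laplacian c ?p y * l y)"
      unfolding ell2_inner by (rule infsum_eq_sum) (use finite_support_laplacian[OF p] in auto)
    also have "\<dots> = laplacian c l x"
      unfolding sum_laplacian_swap[OF p] supp by (simp add: point_mass_def)
    finally have 1: "hinner ell2 (laplacian c ?p) l = laplacian c l x" .
    have "hinner ell2 ?p l = (\<Sum>y\<in>{x}. ?p y * l y)"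
      unfolding ell2_inner by (rule infsum_eq_sum) (auto simp: point_mass_def)
    then have 2: "hinner ell2 ?p l = l x" by (simp add: point_mass_def)
    have "T ?p = hadd ell2 (laplacian c ?p) ?p" by (simp add: T_def fun_eq_iff)
    then have "hinner ell2 (laplacian c ?p) l + hinner ell2 ?p l = 0"
      using orth[OF p] Lc pc d(5) by (simp del: ell2_ops)
    then show ?thesis using 1 2 by simp
  qed
  have "l x \<le> 0" for x by (rule laplacian_eigenvector_minus_one_nonpos[OF d(5) eig])
  moreover have "-1 * l x \<le> 0" for x
  proof (rule laplacian_eigenvector_minus_one_nonpos)
    show "(\<lambda>x. -1 * l x) \<in> hcarrier ell2" by (rule ell2_scale[OF d(5)])
    show "laplacian c (\<lambda>x. -1 * l x) x = - (-1 * l x)" for x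
      by (simp only: laplacian_scale eig)
  qed
  ultimately have "l x = 0" for x by (simp add: order_antisym)
  then have "(\<lambda>n. hinner ell2 (f n) (f n)) \<longlonglongrightarrow> 0" using d(6) by simp
  then have "\<forall>\<^sub>F n in sequentially. hinner ell2 (f n) (f n) < e" using e by (rule order_tendstoD)
  then obtain n where n: "hinner ell2 (f n) (f n) < e" by (auto simp: eventually_sequentially)
  obtain \<eta> where "finite {x. \<eta> x \<noteq> 0}" "f n = (\<lambda>x. \<xi> x - T \<eta> x)" using d(2) by (auto simp: K_def)
  then show ?thesis using n by (auto simp: T_def)
qed

end

section \<open>The intertwining map\<close>

locale transient_conductance = conductance c for c :: "'v \<Rightarrow> 'v \<Rightarrow> real" +
  fixes x0 :: 'v
  assumes transient: "transient c"
begin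

abbreviation W :: "'v \<Rightarrow> 'v \<Rightarrow> real" where
  "W x \<equiv> rep (wv c x0 x)"

lemma W: 
  obtains k where "W x = (\<lambda>y. rep (min_monopole c x0) y + rep (dipole c x0 x) y + k)"
proof -
  let ?u = "\<lambda>y. rep (min_monopole c x0) y + rep (dipole c x0 x) y"
  obtain k where "rep (const_class ?u) = (\<lambda>y. ?u y + k)" by (rule rep_class)
  moreover have "wv c x0 x = const_class ?u" by (simp add: wv_def energy_space_def)
  ultimately show thesis using that[of k] by simp
qed

lemma min_monopole_dom: "rep (min_monopole c x0) \<in> dom_energy c"
  using min_monopole[OF transient] rep_dom_energy by (auto simp: monopole_def)

lemma wv_carrier: "wv c x0 x \<in> hcarrier E"
  unfolding wv_def using min_monopole[OF transient] dipole_carrier inner_space.add_closed[OF inner_space_E]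
  by (simp add: monopole_def)

lemma W_dom: "W x \<in> dom_energy c"
  by (rule rep_dom_energy[OF wv_carrier])

lemma laplacian_W: "laplacian c (W x) y = point_mass x y"
proof -
  obtain k where "W x = (\<lambda>y. rep (min_monopole c x0) y + rep (dipole c x0 x) y + k)" by (rule W)
  then show ?thesis
    using min_monopole[OF transient, of x0]
    by (simp add: laplacian_shift laplacian_add laplacian_dipole monopole_def)
qed

text \<open>The first summand does not depend on \<open>x\<close>; it drops out against coefficients of total sum \<open>0\<close>.\<close>

lemma energy_W:
  assumes u: "u \<in> dom_energy c"
  shows "energy c (W x) u = energy c (rep (min_monopole c x0)) u + (u x - u x0)"
proof -
  obtain k where k: "W x = (\<lambda>y. rep (min_monopole c x0) y + rep (dipole c x0 x) y + k)" by (rule W)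
  have "energy c (W x) u = energy c (\<lambda>y. rep (min_monopole c x0) y + rep (dipole c x0 x) y) u"
    unfolding k by (simp add: energy_def)
  also have "\<dots> = energy c (rep (min_monopole c x0)) u + energy c (rep (dipole c x0 x)) u"
    using min_monopole_dom rep_dom_energy[OF dipole_carrier] u by (rule energy_add)
  finally show ?thesis using energy_dipole[OF u] by simp
qed

lemma Phi_superset:
  assumes "finite S" "{x. \<xi> x \<noteq> 0} \<subseteq> S"
  shows "Phi c x0 \<xi> = const_class (\<lambda>y. \<Sum>x\<in>S. \<xi> x * W x y)"
proof -
  have "(\<Sum>x | \<xi> x \<noteq> 0. \<xi> x * W x y) = (\<Sum>x\<in>S. \<xi> x * W x y)" for y
    using assms by (intro sum.mono_neutral_left) auto
  then show ?thesis by (simp add: Phi_def)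
qed

lemma Phi_carrier: "finite {x. \<xi> x \<noteq> 0} \<Longrightarrow> Phi c x0 \<xi> \<in> hcarrier E"
  unfolding Phi_def by (intro class_carrier dom_energy_sum W_dom)

lemma Phi_add:
  assumes "finite {x. \<xi> x \<noteq> 0}" "finite {x. \<eta> x \<noteq> 0}"
  shows "Phi c x0 (\<lambda>x. \<xi> x + \<eta> x) = hadd E (Phi c x0 \<xi>) (Phi c x0 \<eta>)"
proof -
  let ?S = "{x. \<xi> x \<noteq> 0} \<union> {x. \<eta> x \<noteq> 0}"
  have S: "finite ?S" using assms by simp
  have "Phi c x0 (\<lambda>x. \<xi> x + \<eta> x) = const_class (\<lambda>y. \<Sum>x\<in>?S. (\<xi> x + \<eta> x) * W x y)"
    by (rule Phi_superset[OF S]) auto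
  also have "\<dots> = hadd E (Phi c x0 \<xi>) (Phi c x0 \<eta>)"
    using Phi_superset[OF S, of \<xi>] Phi_superset[OF S, of \<eta>]
    by (simp add: E_add distrib_right sum.distrib)
  finally show ?thesis .
qed

text \<open>
  The energy product of \<open>\<Phi>(\<Delta>\<xi>)\<close> with \<open>z\<close> is the sum of \<open>\<Delta>\<xi> x (z x + k)\<close> for a constant \<open>k\<close>. Moving
  the Laplacian to the other factor kills \<open>k\<close> and leaves the sum of \<open>\<xi> x \<Delta>z x\<close>, the energy product
  of \<open>\<xi>\<close> with \<open>z\<close>. Taking for \<open>z\<close> the difference of the two sides shows that it has energy \<open>0\<close>.
\<close>

lemma Phi_laplacian:
  assumes \<xi>: "finite {x. \<xi> x \<noteq> 0}"
  shows "Phi c x0 (laplacian c \<xi>) = const_class \<xi>"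
proof -
  let ?L = "laplacian c \<xi>"
  note L = finite_support_laplacian[OF \<xi>]
  define \<phi> where "\<phi> y = (\<Sum>x | ?L x \<noteq> 0. ?L x * W x y)" for y
  have \<phi>: "\<phi> \<in> dom_energy c" unfolding \<phi>_def by (intro dom_energy_sum W_dom L)
  have \<xi>d: "\<xi> \<in> dom_energy c" using \<xi> by (rule finite_support_dom_energy)
  define z where "z y = \<phi> y - \<xi> y" for y
  have z: "z \<in> dom_energy c" unfolding z_def using \<phi> \<xi>d by (rule dom_energy_diff)
  define k where "k = energy c (rep (min_monopole c x0)) z - z x0"
  have "energy c \<phi> z = (\<Sum>x | ?L x \<noteq> 0. ?L x * energy c (W x) z)"
    unfolding \<phi>_def by (intro energy_sum z L W_dom)
  also have "\<dots> = (\<Sum>x | ?L x \<noteq> 0. ?L x * (z x + k))"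
    by (simp add: energy_W[OF z] k_def algebra_simps)
  also have "\<dots> = (\<Sum>x | \<xi> x \<noteq> 0. \<xi> x * laplacian c (\<lambda>x. z x + k) x)"
    by (rule sum_laplacian_swap[OF \<xi>])
  also have "\<dots> = energy c \<xi> z" by (simp add: laplacian_shift energy_finite_support[OF z \<xi>])
  finally have "energy c z z = 0" using energy_diff[OF \<phi> \<xi>d z] by (simp add: z_def[abs_def])
  then have "const_class \<phi> = const_class \<xi>"
    using class_eq_if_energy_zero[OF \<phi> \<xi>d] by (simp add: z_def[abs_def])
  then show ?thesis by (simp add: Phi_def \<phi>_def[abs_def])
qed

lemma laplacian_Phi:
  assumes \<xi>: "finite {x. \<xi> x \<noteq> 0}"
  shows "laplacian c (rep (Phi c x0 \<xi>)) = \<xi>"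
proof
  fix y
  have "laplacian c (rep (Phi c x0 \<xi>)) y = (\<Sum>x | \<xi> x \<noteq> 0. \<xi> x * point_mass x y)"
    unfolding Phi_def laplacian_rep using \<xi> by (simp add: laplacian_sum laplacian_W)
  also have "\<dots> = \<xi> y" using point_mass_expansion[OF \<xi> order_refl] by (rule fun_cong[symmetric])
  finally show "laplacian c (rep (Phi c x0 \<xi>)) y = \<xi> y" .
qed

lemma Phi_in_span:
  assumes "finite {x. \<xi> x \<noteq> 0}"
  shows "Phi c x0 \<xi> \<in> hspan E (range (wv c x0))"
proof -
  have "const_class (\<lambda>y. \<Sum>x | \<xi> x \<noteq> 0. \<xi> x * W x y) \<in> V"
    if V: "hsubspace E V" and S: "range (wv c x0) \<subseteq> V" for V
  proof (rule sum_in_subspace[where s = const_class, OF V S assms])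
    show "hzero E = const_class (\<lambda>_. 0)" by (simp add: energy_space_def)
    show "const_class (W x) \<in> range (wv c x0)" for x by (simp add: class_rep[OF wv_carrier])
  qed (rule E_add E_scale)+
  then show ?thesis by (auto simp: hspan_def Phi_def)
qed

lemma Delta_E_Phi:
  assumes \<xi>: "finite {x. \<xi> x \<noteq> 0}"
  shows "(Phi c x0 \<xi>, Phi c x0 (laplacian c \<xi>)) \<in> Delta_E c x0"
proof -
  have "Phi c x0 (laplacian c \<xi>) = const_class (laplacian c (rep (Phi c x0 \<xi>)))"
    by (simp add: laplacian_Phi[OF \<xi>] Phi_laplacian[OF \<xi>])
  then have "(Phi c x0 \<xi>, Phi c x0 (laplacian c \<xi>)) \<in>
      {(u, const_class (laplacian c (rep u))) |u. u \<in> hspan E (range (wv c x0))}"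
    using Phi_in_span[OF \<xi>] by blast
  then show ?thesis
    unfolding Delta_E_def
    by (rule inner_space.op_closure_contains[OF inner_space_E])
      (intro Phi_carrier finite_support_laplacian \<xi>)+
qed

lemma inner_Phi:
  assumes \<xi>: "finite {x. \<xi> x \<noteq> 0}"
  shows "hinner E (Phi c x0 \<xi>) (Phi c x0 (laplacian c \<xi>)) = hinner ell2 \<xi> \<xi>"
proof -
  let ?u = "rep (Phi c x0 \<xi>)"
  have u: "?u \<in> dom_energy c" using Phi_carrier[OF \<xi>] by (rule rep_dom_energy)
  have "hinner E (const_class ?u) (const_class \<xi>) = energy c \<xi> ?u"
    by (simp add: hinner_energy_space energy_commute)
  also have "\<dots> = (\<Sum>x | \<xi> x \<noteq> 0. \<xi> x * \<xi> x)"
    by (simp add: energy_finite_support[OF u \<xi>] laplacian_Phi[OF \<xi>])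
  also have "\<dots> = hinner ell2 \<xi> \<xi>"
    unfolding ell2_inner using \<xi> by (intro infsum_eq_sum[symmetric]) auto
  finally show ?thesis by (simp add: Phi_laplacian[OF \<xi>] class_rep[OF Phi_carrier[OF \<xi>]])
qed

end

lemma (in conductance) Delta_2_finite_support:
  assumes \<xi>: "finite {x. \<xi> x \<noteq> 0}"
  shows "(\<xi>, laplacian c \<xi>) \<in> Delta_2 c"
proof -
  have "(\<xi>, laplacian c \<xi>) \<in> {(u, laplacian c u) |u. u \<in> dom_Phi}"
    using \<xi> by (auto simp: dom_Phi_iff)
  then show ?thesis
    unfolding Delta_2_def using \<xi>
    by (intro ell2.op_closure_contains) (simp_all add: finite_support_laplacian finite_support_ell2)
qed

section \<open>Comparison of the two spectral measures\<close>

text \<open>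
  \<open>X\<close> and \<open>Y\<close> stand for bounded non-negative quadratic forms, of which only the weak triangle
  inequality of \<open>emeasure_spectral_add_le\<close> is used: it compares the value at \<open>\<xi>\<close> with the value at
  a nearby \<open>a\<close>. In the resulting bound, first the distance tends to \<open>0\<close>, then \<open>e\<close>.
\<close>

lemma le_by_density:
  assumes X: "\<And>a b e. a \<in> V \<Longrightarrow> b \<in> V \<Longrightarrow> 0 < e \<Longrightarrow>
      X (\<lambda>x. a x + b x) \<le> (1 + e) * X a + (1 + 1 / e) * (X b :: real)"
    and Y: "\<And>a b e. a \<in> V \<Longrightarrow> b \<in> V \<Longrightarrow> 0 < e \<Longrightarrow>
      Y (\<lambda>x. a x + b x) \<le> (1 + e) * Y a + (1 + 1 / e) * (Y b :: real)"
    and XN: "\<And>a. a \<in> V \<Longrightarrow> X a \<le> hinner ell2 a a"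
    and YN: "\<And>a. a \<in> V \<Longrightarrow> Y a \<le> hinner ell2 a a"
    and diff: "\<And>a b. a \<in> V \<Longrightarrow> b \<in> V \<Longrightarrow> (\<lambda>x. a x - b x) \<in> V"
    and dense: "\<And>d. 0 < d \<Longrightarrow> \<exists>a\<in>V. X a = Y a \<and> hinner ell2 (\<lambda>x. \<xi> x - a x) (\<lambda>x. \<xi> x - a x) < d"
    and \<xi>: "\<xi> \<in> V"
  shows "X \<xi> \<le> (Y \<xi> :: real)"
proof -
  have bound: "X \<xi> \<le> (1 + e) * ((1 + e) * Y \<xi> + (1 + 1 / e) * d) + (1 + 1 / e) * d"
    if e: "0 < e" and d: "0 < d" for e d
  proof -
    obtain a where a: "a \<in> V" "X a = Y a" "hinner ell2 (\<lambda>x. \<xi> x - a x) (\<lambda>x. \<xi> x - a x) < d"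
      using dense[OF d] by blast
    have sym: "hinner ell2 (\<lambda>x. a x - \<xi> x) (\<lambda>x. a x - \<xi> x) = hinner ell2 (\<lambda>x. \<xi> x - a x) (\<lambda>x. \<xi> x - a x)"
    proof -
      have "(a x - \<xi> x) * (a x - \<xi> x) = (\<xi> x - a x) * (\<xi> x - a x)" for x by (simp add: algebra_simps)
      then show ?thesis by (simp only: ell2_inner)
    qed
    have "X \<xi> = X (\<lambda>x. a x + (\<xi> x - a x))" by simp
    also have "\<dots> \<le> (1 + e) * X a + (1 + 1 / e) * X (\<lambda>x. \<xi> x - a x)"
      using a \<xi> e diff by (intro X)
    also have "\<dots> \<le> (1 + e) * Y a + (1 + 1 / e) * d"
      using e a XN[OF diff[OF \<xi> a(1)]] by (intro add_mono mult_left_mono) auto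
    also have "Y a = Y (\<lambda>x. \<xi> x + (a x - \<xi> x))" by simp
    also have "\<dots> \<le> (1 + e) * Y \<xi> + (1 + 1 / e) * Y (\<lambda>x. a x - \<xi> x)"
      using a \<xi> e diff by (intro Y)
    also have "\<dots> \<le> (1 + e) * Y \<xi> + (1 + 1 / e) * d"
      using e a YN[OF diff[OF a(1) \<xi>]] sym by (intro add_mono mult_left_mono) auto
    finally show ?thesis using e by simp
  qed
  have "X \<xi> \<le> (1 + e) * ((1 + e) * Y \<xi>)" if e: "0 < e" for e
  proof (rule tendsto_lowerbound)
    show "((\<lambda>d. (1 + e) * ((1 + e) * Y \<xi> + (1 + 1 / e) * d) + (1 + 1 / e) * d)
        \<longlongrightarrow> (1 + e) * ((1 + e) * Y \<xi>)) (at_right 0)"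
      by (auto intro!: tendsto_eq_intros)
    show "\<forall>\<^sub>F d in at_right 0. X \<xi> \<le> (1 + e) * ((1 + e) * Y \<xi> + (1 + 1 / e) * d) + (1 + 1 / e) * d"
      using eventually_at_right_less by (rule eventually_mono) (rule bound[OF e])
  qed simp
  then have "\<forall>\<^sub>F e in at_right 0. X \<xi> \<le> (1 + e) * ((1 + e) * Y \<xi>)"
    using eventually_at_right_less by (rule eventually_mono[rotated])
  moreover have "((\<lambda>e. (1 + e) * ((1 + e) * Y \<xi>)) \<longlongrightarrow> Y \<xi>) (at_right 0)"
    by (auto intro!: tendsto_eq_intros)
  ultimately show ?thesis by (intro tendsto_lowerbound) auto
qed

lemma resolvent_weight_measurable [measurable]:
  "(\<lambda>l::real. ennreal (1 / (1 + l)\<^sup>2) ^ k) \<in> borel_measurable halfline"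
  by (rule measurable_restrict_space1) measurable

lemma resolvent_weight_le_one: "0 \<le> l \<Longrightarrow> ennreal (1 / (1 + l)\<^sup>2) ^ k \<le> 1"
proof -
  assume "0 \<le> l"
  then have "(1 / (1 + l)\<^sup>2) ^ k \<le> 1" by (intro power_le_one) (auto simp: divide_le_eq one_le_power)
  then show ?thesis by (simp add: ennreal_power)
qed

lemma resolvent_weight_Suc:
  "0 \<le> l \<Longrightarrow> ennreal ((1 + l)\<^sup>2) * ennreal (1 / (1 + l)\<^sup>2) ^ Suc k = ennreal (1 / (1 + l)\<^sup>2) ^ k"
  by (simp add: mult.assoc[symmetric] flip: ennreal_mult)

context halfline_pvm
begin

text \<open>The density \<open>(1 + \<lambda>)\<^sup>2\<close> absorbs one power of the squared resolvent. The factor \<open>g\<close> is \<open>\<lambda>\<close> for the energy space and \<open>1\<close> for square summable functions.\<close>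

lemma weighted_op_plus_id:
  assumes "(u, w) \<in> op" and g: "g \<in> borel_measurable halfline"
  shows "(\<integral>\<^sup>+ l. g l * ennreal (1 / (1 + l)\<^sup>2) ^ Suc k \<partial>\<mu> (hadd H w u))
    = (\<integral>\<^sup>+ l. g l * ennreal (1 / (1 + l)\<^sup>2) ^ k \<partial>\<mu> u)"
proof -
  have m: "(\<lambda>l::real. ennreal ((1 + l)\<^sup>2)) \<in> borel_measurable halfline"
    by (rule measurable_restrict_space1) measurable
  have "(\<integral>\<^sup>+ l. g l * ennreal (1 / (1 + l)\<^sup>2) ^ Suc k \<partial>\<mu> (hadd H w u))
      = (\<integral>\<^sup>+ l. ennreal ((1 + l)\<^sup>2) * (g l * ennreal (1 / (1 + l)\<^sup>2) ^ Suc k) \<partial>\<mu> u)"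
    unfolding spectral_op_plus_id[OF assms(1)] using m g
    by (intro nn_integral_density borel_measurable_times resolvent_weight_measurable)
      (simp_all cong: measurable_cong_sets)
  also have "\<dots> = (\<integral>\<^sup>+ l. g l * ennreal (1 / (1 + l)\<^sup>2) ^ k \<partial>\<mu> u)"
    by (intro nn_integral_cong)
      (simp only: space_spectral halfline_nonneg mult.left_commute[of _ "g _"] resolvent_weight_Suc)
  finally show ?thesis .
qed

end

lemma enn2real_le_lincomb:
  assumes "i \<le> ennreal p * j + ennreal q * m" "j < \<infinity>" "m < \<infinity>" "0 \<le> p" "0 \<le> q"
  shows "enn2real i \<le> p * enn2real j + q * enn2real m"
proof -
  obtain r s where rs: "j = ennreal r" "m = ennreal s" "0 \<le> r" "0 \<le> s"
    using assms(2,3) by (metis ennreal_cases infinity_ennreal_def less_irrefl)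
  then have "i \<le> ennreal (p * r + q * s)" using assms by (simp add: ennreal_mult)
  then have "enn2real i \<le> p * r + q * s" using rs assms by (intro enn2real_leI) auto
  then show ?thesis using rs by simp
qed

context transient_conductance
begin

text \<open>
  \<open>I k f\<close> and \<open>J k f\<close> are the integrals of the \<open>k\<close>-th power of \<open>1 / (1 + \<lambda>)\<^sup>2\<close> against \<open>\<lambda> d\<mu>\<close> at \<open>\<Phi>f\<close>
  and against the spectral measure at \<open>f\<close>. They agree for \<open>k = 0\<close> because both are \<open>\<parallel>f\<parallel>\<^sup>2\<close>; the
  induction step is the agreement on the dense range of \<open>\<Delta> + 1\<close>.
\<close>

lemma spectral_measures_related:
  assumes ext: "Delta_E c x0 \<subseteq> Delta_F"
    and res_F: "spectral_resolution E Delta_F P_F"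
    and res_2: "spectral_resolution ell2 (Delta_2 c) P_2"
    and \<xi>: "finite {x. \<xi> x \<noteq> 0}"
  shows "density (spectral_measure E halfline P_F (Phi c x0 \<xi>)) (\<lambda>l. ennreal l)
    = spectral_measure ell2 halfline P_2 \<xi>"
proof -
  interpret F: halfline_pvm E P_F
    using res_F by (intro halfline_pvm.intro pvm_space.intro inner_space_E pvm_space_axioms.intro)
      (simp add: spectral_resolution_def)
  interpret L: halfline_pvm ell2 P_2
    using res_2 by (intro halfline_pvm.intro pvm_space.intro ell2.inner_space_axioms pvm_space_axioms.intro)
      (simp add: spectral_resolution_def)
  let ?V = "{f :: 'v \<Rightarrow> real. finite {x. f x \<noteq> 0}}"
  let ?r = "\<lambda>k l::real. ennreal (1 / (1 + l)\<^sup>2) ^ k"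
  let ?N = "\<lambda>f. hinner ell2 f f"
  define I where "I k f = (\<integral>\<^sup>+ l. ennreal l * ?r k l \<partial>F.\<mu> (Phi c x0 f))" for k f
  define J where "J k f = (\<integral>\<^sup>+ l. 1 * ?r k l \<partial>L.\<mu> f)" for k f
  have op_F: "(Phi c x0 f, Phi c x0 (laplacian c f)) \<in> F.op" if "f \<in> ?V" for f
    using Delta_E_Phi[of f] that ext res_F by (auto simp: spectral_resolution_def)
  have op_L: "(f, laplacian c f) \<in> L.op" if "f \<in> ?V" for f
    using Delta_2_finite_support[of f] that res_2 by (simp add: spectral_resolution_def)
  have LV: "laplacian c f \<in> ?V" if "f \<in> ?V" for f using that finite_support_laplacian by simp
  have add: "(\<lambda>x. f x + g x) \<in> ?V" if "f \<in> ?V" "g \<in> ?V" for f g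
    using finite_support_add that by simp
  have diff: "(\<lambda>x. f x - g x) \<in> ?V" if "f \<in> ?V" "g \<in> ?V" for f g
    using finite_support_add[OF _ finite_support_scale[of g "-1"], of f] that by simp
  have wm: "(\<lambda>l. ennreal l * ?r k l) \<in> borel_measurable halfline" for k
    by (intro borel_measurable_times resolvent_weight_measurable measurable_compose[OF F.id_measurable]) simp
  have mass_F: "F.mean (Phi c x0 f) = ennreal (?N f)" if f: "f \<in> ?V" for f
  proof -
    have "F.mean (Phi c x0 f) = (\<integral>\<^sup>+ l. indicator (space halfline) l * ennreal l \<partial>F.\<mu> (Phi c x0 f))"
      by (intro nn_integral_cong) simp
    also have "\<dots> = ennreal (F.form (space halfline) (Phi c x0 f) (Phi c x0 (laplacian c f)))"
      by (rule F.op_form(1)[OF op_F[OF f] sets.top])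
    also have "\<dots> = ennreal (?N f)"
      using f by (simp only: F.form_space Phi_carrier inner_Phi mem_Collect_eq)
    finally show ?thesis .
  qed
  have mass_L: "emeasure (L.\<mu> f) (space halfline) = ennreal (?N f)" if f: "f \<in> ?V" for f
  proof -
    have "f \<in> hcarrier ell2" using f finite_support_ell2 by simp
    then show ?thesis by (simp only: L.emeasure_spectral[OF _ sets.top] L.form_space)
  qed
  have I_le: "I k f \<le> ennreal (?N f)" if f: "f \<in> ?V" for k f
  proof -
    have "I k f \<le> F.mean (Phi c x0 f)"
      unfolding I_def
      by (intro nn_integral_mono order_trans[OF mult_left_mono[OF resolvent_weight_le_one]])
        (auto simp: space_restrict_space)
    then show ?thesis by (simp only: mass_F[OF f])
  qed
  have J_le: "J k f \<le> ennreal (?N f)" if f: "f \<in> ?V" for k f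
  proof -
    have "J k f \<le> (\<integral>\<^sup>+ l. 1 \<partial>L.\<mu> f)"
      unfolding J_def by (intro nn_integral_mono) (simp add: resolvent_weight_le_one space_restrict_space)
    then show ?thesis using mass_L[OF f] by simp
  qed
  have I_add: "I k (\<lambda>x. f x + g x) \<le> ennreal (1 + e) * I k f + ennreal (1 + 1 / e) * I k g"
    if f: "f \<in> ?V" and g: "g \<in> ?V" and e: "0 < e" for k f g e
  proof -
    have fg: "Phi c x0 (\<lambda>x. f x + g x) = hadd E (Phi c x0 f) (Phi c x0 g)"
      using f g by (simp add: Phi_add)
    show ?thesis
      unfolding I_def fg
    proof (rule nn_integral_le_measure_sum)
      fix X assume "X \<in> sets (F.\<mu> (hadd E (Phi c x0 f) (Phi c x0 g)))"
      then show "emeasure (F.\<mu> (hadd E (Phi c x0 f) (Phi c x0 g))) X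
          \<le> ennreal (1 + e) * emeasure (F.\<mu> (Phi c x0 f)) X + ennreal (1 + 1 / e) * emeasure (F.\<mu> (Phi c x0 g)) X"
        using f g e by (intro F.emeasure_spectral_add_le) (simp_all add: Phi_carrier)
    qed (use wm in \<open>simp_all cong: measurable_cong_sets\<close>)
  qed
  have J_add: "J k (\<lambda>x. f x + g x) \<le> ennreal (1 + e) * J k f + ennreal (1 + 1 / e) * J k g"
    if f: "f \<in> ?V" and g: "g \<in> ?V" and e: "0 < e" for k f g e
    unfolding J_def
  proof (rule nn_integral_le_measure_sum)
    fix X assume "X \<in> sets (L.\<mu> (\<lambda>x. f x + g x))"
    then show "emeasure (L.\<mu> (\<lambda>x. f x + g x)) X
        \<le> ennreal (1 + e) * emeasure (L.\<mu> f) X + ennreal (1 + 1 / e) * emeasure (L.\<mu> g) X"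
      using f g e L.emeasure_spectral_add_le[of f g X e] by (simp add: finite_support_ell2)
  qed (use resolvent_weight_measurable in \<open>simp_all cong: measurable_cong_sets\<close>)
  have I_step: "I (Suc k) (\<lambda>x. laplacian c f x + f x) = I k f" if f: "f \<in> ?V" for k f
    using F.weighted_op_plus_id[OF op_F[OF f], of ennreal k] f LV[OF f] measurable_compose[OF F.id_measurable measurable_ennreal]
    by (simp only: I_def Phi_add mem_Collect_eq)
  have J_step: "J (Suc k) (\<lambda>x. laplacian c f x + f x) = J k f" if f: "f \<in> ?V" for k f
    using L.weighted_op_plus_id[OF op_L[OF f], of "\<lambda>_. 1" k] by (simp add: J_def)
  have fin: "I k f < \<infinity>" "J k f < \<infinity>" if "f \<in> ?V" for k f
    using le_less_trans[OF I_le[OF that] ennreal_less_top] le_less_trans[OF J_le[OF that] ennreal_less_top]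
    by simp_all
  have N0: "0 \<le> ?N f" if "f \<in> ?V" for f
    using that finite_support_ell2 ell2.inner_nonneg by blast
  have eq: "enn2real (I k f) = enn2real (J k f)" if "f \<in> ?V" for k f
    using that
  proof (induction k arbitrary: f)
    case 0
    then show ?case using mass_F[of f] mass_L[of f] by (simp add: I_def J_def)
  next
    case (Suc k)
    have Iadd: "enn2real (I (Suc k) (\<lambda>x. a x + b x))
        \<le> (1 + e) * enn2real (I (Suc k) a) + (1 + 1 / e) * enn2real (I (Suc k) b)"
      if "a \<in> ?V" "b \<in> ?V" "0 < e" for a b e
      using that fin by (intro enn2real_le_lincomb I_add) auto
    have Jadd: "enn2real (J (Suc k) (\<lambda>x. a x + b x))
        \<le> (1 + e) * enn2real (J (Suc k) a) + (1 + 1 / e) * enn2real (J (Suc k) b)"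
      if "a \<in> ?V" "b \<in> ?V" "0 < e" for a b e
      using that fin by (intro enn2real_le_lincomb J_add) auto
    have Ile: "enn2real (I (Suc k) a) \<le> ?N a" and Jle: "enn2real (J (Suc k) a) \<le> ?N a" if "a \<in> ?V" for a
      using I_le[OF that] J_le[OF that] N0[OF that] by (auto intro: enn2real_leI)
    have dense: "\<exists>a\<in>?V. enn2real (I (Suc k) a) = enn2real (J (Suc k) a) \<and>
        hinner ell2 (\<lambda>x. f x - a x) (\<lambda>x. f x - a x) < d" if d: "0 < d" for d
    proof -
      obtain g where "finite {x. g x \<noteq> 0}" and close: "hinner ell2 (\<lambda>x. f x - (laplacian c g x + g x))
          (\<lambda>x. f x - (laplacian c g x + g x)) < d"
        using dense_range[OF Suc.prems[unfolded mem_Collect_eq] d] by blast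
      then have g: "g \<in> ?V" by simp
      let ?a = "\<lambda>x. laplacian c g x + g x"
      have "?a \<in> ?V" using add[OF LV[OF g] g] .
      moreover have "enn2real (I (Suc k) ?a) = enn2real (J (Suc k) ?a)"
        unfolding I_step[OF g] J_step[OF g] by (rule Suc.IH[OF g])
      ultimately show ?thesis using close by (intro bexI[of _ ?a] conjI)
    qed
    have dense': "\<exists>a\<in>?V. enn2real (J (Suc k) a) = enn2real (I (Suc k) a) \<and>
        hinner ell2 (\<lambda>x. f x - a x) (\<lambda>x. f x - a x) < d" if d: "0 < d" for d
    proof -
      obtain a where "a \<in> ?V" "enn2real (I (Suc k) a) = enn2real (J (Suc k) a)"
          "hinner ell2 (\<lambda>x. f x - a x) (\<lambda>x. f x - a x) < d"
        using dense[OF d] by (elim bexE conjE)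
      then show ?thesis by (intro bexI[of _ a] conjI) simp_all
    qed
    show ?case
      using le_by_density[of ?V "\<lambda>f. enn2real (I (Suc k) f)" "\<lambda>f. enn2real (J (Suc k) f)",
          OF Iadd Jadd Ile Jle diff dense Suc.prems]
        le_by_density[of ?V "\<lambda>f. enn2real (J (Suc k) f)" "\<lambda>f. enn2real (I (Suc k) f)",
          OF Jadd Iadd Jle Ile diff dense' Suc.prems]
      by (rule order_antisym)
  qed
  have \<xi>V: "\<xi> \<in> ?V" using \<xi> by simp
  have m: "ennreal \<in> borel_measurable (F.\<mu> (Phi c x0 \<xi>))"
    using measurable_compose[OF F.id_measurable measurable_ennreal] by (simp cong: measurable_cong_sets)
  show ?thesis
  proof (rule measure_eq_if_resolvent_moments_eq)
    show "finite_measure (density (F.\<mu> (Phi c x0 \<xi>)) (\<lambda>l. ennreal l))"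
    proof (rule finite_measureI)
      have top: "{0..} \<in> sets halfline"
        using sets.top[of halfline] by (simp add: space_restrict_space)
      have "emeasure (density (F.\<mu> (Phi c x0 \<xi>)) (\<lambda>l. ennreal l)) (space halfline) = F.mean (Phi c x0 \<xi>)"
        using m by (subst emeasure_density) (auto intro!: nn_integral_cong simp: top space_restrict_space)
      then show "emeasure (density (F.\<mu> (Phi c x0 \<xi>)) (\<lambda>l. ennreal l))
          (space (density (F.\<mu> (Phi c x0 \<xi>)) (\<lambda>l. ennreal l))) \<noteq> \<infinity>"
        using mass_F[OF \<xi>V] by simp
    qed
    show "finite_measure (L.\<mu> \<xi>)" by (rule L.finite_spectral[OF finite_support_ell2[OF \<xi>]])
    show "(\<integral>\<^sup>+ l. ?r k l \<partial>density (F.\<mu> (Phi c x0 \<xi>)) (\<lambda>l. ennreal l)) = (\<integral>\<^sup>+ l. ?r k l \<partial>L.\<mu> \<xi>)" for k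
    proof -
      have "(\<integral>\<^sup>+ l. ?r k l \<partial>density (F.\<mu> (Phi c x0 \<xi>)) (\<lambda>l. ennreal l)) = I k \<xi>"
        unfolding I_def using m resolvent_weight_measurable
        by (intro nn_integral_density) (simp_all cong: measurable_cong_sets)
      also have "\<dots> = J k \<xi>"
        using eq[OF \<xi>V, of k] fin[OF \<xi>V] by (metis ennreal_enn2real infinity_ennreal_def)
      finally show ?thesis by (simp add: J_def)
    qed
  qed simp_all
qed

end

section \<open>The Radon--Nikodym derivative on the open half-line\<close>

text \<open>Away from \<open>0\<close> the density \<open>\<lambda>\<close> is positive, so it does not create null sets; at \<open>0\<close> it would
  destroy an atom of \<open>M\<close>, which is why the restriction is needed.\<close>

lemma restrict_density_id:
  fixes M N :: "real measure"
  assumes sets: "sets M = sets halfline" and fin: "finite_measure M"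
    and dens: "density M (\<lambda>l. ennreal l) = N"
  shows "absolutely_continuous (restrict_space M {0<..}) (restrict_space N {0<..})"
    and "absolutely_continuous (restrict_space N {0<..}) (restrict_space M {0<..})"
    and "AE l in restrict_space M {0<..}.
      RN_deriv (restrict_space M {0<..}) (restrict_space N {0<..}) l = ennreal l"
proof -
  let ?M = "restrict_space M {0<..}" and ?N = "restrict_space N {0<..}"
  have sp: "space M = {0..}" using sets_eq_imp_space_eq[OF sets] by (simp add: space_restrict_space)
  have spM: "space ?M = {0<..}" by (auto simp: space_restrict_space sp)
  have "{0<..} \<inter> {0::real..} \<in> sets halfline"
    unfolding sets_restrict_space by (rule image_eqI[of _ _ "{0<..}"]) auto
  then have pos: "{0<..} \<inter> space M \<in> sets M" unfolding sets sp .
  have m: "(\<lambda>l. ennreal l) \<in> borel_measurable M"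
    using measurable_restrict_space1[of ennreal borel borel "{0..}"] sets by (simp cong: measurable_cong_sets)
  then have mr: "(\<lambda>l. ennreal l) \<in> borel_measurable ?M" by (rule measurable_restrict_space1)
  have eq: "density ?M (\<lambda>l. ennreal l) = ?N"
  proof (rule measure_eqI)
    show "sets (density ?M (\<lambda>l. ennreal l)) = sets ?N"
      by (simp add: sets_restrict_space flip: dens)
    fix A assume "A \<in> sets (density ?M (\<lambda>l. ennreal l))"
    then have A': "A \<in> sets ?M" by simp
    from this[unfolded sets_restrict_space_iff[OF pos]] have A: "A \<in> sets M" "A \<subseteq> {0<..}"
      by simp_all
    have "emeasure (density ?M (\<lambda>l. ennreal l)) A = (\<integral>\<^sup>+ l. ennreal l * indicator A l \<partial>?M)"
      using mr A' by (rule emeasure_density)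
    also have "\<dots> = (\<integral>\<^sup>+ l. ennreal l * indicator A l * indicator {0<..} l \<partial>M)"
      by (rule nn_integral_restrict_space[OF pos])
    also have "\<dots> = (\<integral>\<^sup>+ l. ennreal l * indicator A l \<partial>M)"
      using A(2) by (intro nn_integral_cong) (auto simp: indicator_def)
    also have "\<dots> = emeasure N A"
      unfolding dens[symmetric] by (rule emeasure_density[OF m A(1), symmetric])
    also have "\<dots> = emeasure ?N A"
      unfolding dens[symmetric] using pos A(2) by (intro emeasure_restrict_space[symmetric]) simp_all
    finally show "emeasure (density ?M (\<lambda>l. ennreal l)) A = emeasure ?N A" .
  qed
  show "absolutely_continuous ?M ?N"
    unfolding eq[symmetric] by (rule absolutely_continuousI_density[OF mr])
  show "absolutely_continuous ?N ?M"
    unfolding absolutely_continuous_def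
  proof
    fix A assume "A \<in> null_sets ?N"
    then have A: "A \<in> sets ?M" "AE l in ?M. l \<in> A \<longrightarrow> ennreal l = 0"
      unfolding eq[symmetric] by (simp_all add: null_sets_density_iff[OF mr])
    have "AE l in ?M. l \<notin> A"
      using A(2) AE_space by eventually_elim (auto simp: spM)
    then show "A \<in> null_sets ?M" using A(1) by (simp add: AE_iff_null_sets)
  qed
  interpret finite_measure ?M by (rule finite_measure_restrict_space[OF fin]) (rule pos[folded space_restrict_space, unfolded spM])
  show "AE l in ?M. RN_deriv ?M ?N l = ennreal l"
    using RN_deriv_unique[OF mr eq] by (simp add: eq_commute)
qed

theorem theorem5p2:
  fixes c :: "'v \<Rightarrow> 'v \<Rightarrow> real" and x0 :: 'v
    and Delta_F :: "(('v \<Rightarrow> real) set \<times> ('v \<Rightarrow> real) set) set"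
    and P_F :: "real set \<Rightarrow> ('v \<Rightarrow> real) set \<Rightarrow> ('v \<Rightarrow> real) set"
    and P_2 :: "real set \<Rightarrow> ('v \<Rightarrow> real) \<Rightarrow> ('v \<Rightarrow> real)"
    and \<xi> :: "'v \<Rightarrow> real"
  assumes "network c" and "infinite (UNIV :: 'v set)" and "transient c"
    and "friedrichs_extension (energy_space c) (Delta_E c x0) Delta_F"
    and "spectral_resolution (energy_space c) Delta_F P_F"
    and "spectral_resolution ell2 (Delta_2 c) P_2"
    and "\<xi> \<in> dom_Phi"
    and "\<mu>_F = spectral_measure (energy_space c) halfline P_F (Phi c x0 \<xi>)"
    and "\<mu>_2 = spectral_measure ell2 halfline P_2 \<xi>"
  shows "density \<mu>_F (\<lambda>l. ennreal l) = \<mu>_2 \<and>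
    absolutely_continuous (restrict_space \<mu>_F {0<..}) (restrict_space \<mu>_2 {0<..}) \<and>
    absolutely_continuous (restrict_space \<mu>_2 {0<..}) (restrict_space \<mu>_F {0<..}) \<and>
    (AE l in restrict_space \<mu>_F {0<..}.
       RN_deriv (restrict_space \<mu>_F {0<..}) (restrict_space \<mu>_2 {0<..}) l = ennreal l)"
proof -
  interpret transient_conductance c x0
    using assms(1,3) by unfold_locales
  interpret F: halfline_pvm E P_F
    using assms(5) by (intro halfline_pvm.intro pvm_space.intro inner_space_E pvm_space_axioms.intro)
      (simp add: spectral_resolution_def)
  have \<xi>: "finite {x. \<xi> x \<noteq> 0}" using assms(7) by (simp add: dom_Phi_iff)
  have "Delta_E c x0 \<subseteq> Delta_F" using assms(4) by (simp add: friedrichs_extension_def)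
  then have dens: "density \<mu>_F (\<lambda>l. ennreal l) = \<mu>_2"
    unfolding assms(8,9) using assms(5,6) \<xi> by (rule spectral_measures_related)
  have "sets \<mu>_F = sets halfline" "finite_measure \<mu>_F"
    unfolding assms(8) by (simp, rule F.finite_spectral[OF Phi_carrier[OF \<xi>]])
  then show ?thesis using dens restrict_density_id[OF _ _ dens] by blast
qed

end
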